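(* Let $G$ be a subgroup of $\mathbf V(r,\mathbb R^*_+,\mathbb R)$ such that $G\cap \mathbf F(r,\mathbb R^*_+,\mathbb R)=\mathbf F(r,\Lambda,A)$. Then the group $G$ interprets the Arithmetic $(\mathbb N,+,\times)$ with parameters.
   Context: Maps act on the right: $(\alpha)x$ is the image of $\alpha$ under $x$, and $xy$ means "first $x$, then $y$". Fix a real $r>0$, a subgroup $\Lambda\neq\{1\}$ of the multiplicative group $\mathbb R^*_+$ of positive reals, and an additive subgroup $A\subseteq\mathbb R$ with $r\in A$ and $\lambda A\subseteq A$ for all $\lambda\in\Lambda$ (the same definitions are also used with $\Lambda=\mathbb R^*_+$, $A=\mathbb R$). $\mathbf V(r,\Lambda,A)$ is the group of all bijections $x\colon[0,r)\to[0,r)$ such that: $x$ is piecewise affine with finitely many breakpoints and discontinuity points; $x$ is right-continuous at every point; the slope of each affine piece lies in $\Lambda$; all breakpoints and discontinuity points of $x$, and their images, lie in $A$. $\mathbf F(r,\Lambda,A)$ is the subgroup of elements of $\mathbf V(r,\Lambda,A)$ continuous for the usual topology of $[0,r)$. Groups are viewed as first-order structures in the language with one binary function symbol (multiplication). An interpretation with parameters of a structure $M$ in a structure $N$ is a pair $(n,f)$ with $n\in\mathbb N$ and $f$ a surjection from a subset of $N^n$ onto $M$ such that for every subset $X\subseteq M^k$ definable in $M$ without parameters, the preimage of $X$ under the coordinatewise map $f^{\underline k}$ is first-order definable in $N$ with parameters from $N$; it is an interpretation without parameters if all these preimages are definable without parameters. (Equivalently: the domain of $f$, the kernel equivalence relation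 of $f$, and the preimages of the graphs of all basic relations, operations and constants of $M$ are definable, resp. definable without parameters.) *)

theory Defs
  imports Complex_Main "HOL-Algebra.Group"
begin

text \<open>An element of V(r,Lambda,A) is represented by a function real => real that is the
  identity outside [0,r) and restricts to a bijection of [0,r). The piecewise affine
  structure is witnessed by a subdivision 0 = a 0 < a 1 < ... < a n = r with all
  subdivision points in A, their images in A, and on each [a i, a (i+1)) the map is
  affine with slope in Lambda (this gives right-continuity automatically).\<close>

definition PL_V :: "real \<Rightarrow> real set \<Rightarrow> real set \<Rightarrow> (real \<Rightarrow> real) set" where
  "PL_V r \<Lambda> A = {f.
     (\<forall>t. t \<notin> {0..<r} \<longrightarrow> f t = t) \<and>
     bij_betw f {0..<r} {0..<r} \<and>
     (\<exists>(n::nat) (a::nat \<Rightarrow> real).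
        a 0 = 0 \<and> a n = r \<and>
        (\<forall>i<n. a i < a (Suc i)) \<and>
        (\<forall>i\<le>n. a i \<in> A) \<and>
        (\<forall>i<n. f (a i) \<in> A \<and>
           (\<exists>s\<in>\<Lambda>. \<exists>c. \<forall>t\<in>{a i..<a (Suc i)}. f t = s * t + c)))}"

definition PL_F :: "real \<Rightarrow> real set \<Rightarrow> real set \<Rightarrow> (real \<Rightarrow> real) set" where
  "PL_F r \<Lambda> A = {f \<in> PL_V r \<Lambda> A. continuous_on {0..<r} f}"

text \<open>Maps act on the right: the product x y means first x, then y, i.e. y o x.\<close>

definition Vgrp :: "real \<Rightarrow> real set \<Rightarrow> real set \<Rightarrow> (real \<Rightarrow> real) monoid" where
  "Vgrp r \<Lambda> A = \<lparr>carrier = PL_V r \<Lambda> A, mult = (\<lambda>x y. y \<circ> x), one = id\<rparr>"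

datatype 'tm fm = FEq 'tm 'tm | FNot "'tm fm" | FAnd "'tm fm" "'tm fm" | FEx nat "'tm fm"

fun sat :: "'a set \<Rightarrow> ((nat \<Rightarrow> 'a) \<Rightarrow> 'tm \<Rightarrow> 'a) \<Rightarrow> (nat \<Rightarrow> 'a) \<Rightarrow> 'tm fm \<Rightarrow> bool" where
  "sat D ev e (FEq s t) = (ev e s = ev e t)"
| "sat D ev e (FNot \<phi>) = (\<not> sat D ev e \<phi>)"
| "sat D ev e (FAnd \<phi> \<psi>) = (sat D ev e \<phi> \<and> sat D ev e \<psi>)"
| "sat D ev e (FEx i \<phi>) = (\<exists>a\<in>D. sat D ev (e(i := a)) \<phi>)"

definition env :: "'a \<Rightarrow> 'a list \<Rightarrow> nat \<Rightarrow> 'a" where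
  "env d xs i = (if i < length xs then xs ! i else d)"

datatype gtm = GVar nat | GMul gtm gtm

fun geval :: "('a \<Rightarrow> 'a \<Rightarrow> 'a) \<Rightarrow> (nat \<Rightarrow> 'a) \<Rightarrow> gtm \<Rightarrow> 'a" where
  "geval m e (GVar i) = e i"
| "geval m e (GMul s t) = m (geval m e s) (geval m e t)"

datatype atm = AVar nat | APlus atm atm | ATimes atm atm

fun aeval :: "(nat \<Rightarrow> nat) \<Rightarrow> atm \<Rightarrow> nat" where
  "aeval e (AVar i) = e i"
| "aeval e (APlus s t) = aeval e s + aeval e t"
| "aeval e (ATimes s t) = aeval e s * aeval e t"

definition arith_definable :: "nat \<Rightarrow> nat list set \<Rightarrow> bool" where
  "arith_definable k X \<longleftrightarrow>
     (\<exists>\<phi>::atm fm. X = {ns. length ns = k \<and> sat UNIV aeval (env 0 ns) \<phi>})"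

text \<open>Subsets of S^k definable with parameters in the group (S, m) with identity e
  (parameters are the variables k, k+1, ...; unassigned variables get the identity,
  which is itself definable without parameters).\<close>
definition grp_definable_params ::
  "'a set \<Rightarrow> ('a \<Rightarrow> 'a \<Rightarrow> 'a) \<Rightarrow> 'a \<Rightarrow> nat \<Rightarrow> 'a list set \<Rightarrow> bool" where
  "grp_definable_params S m e k X \<longleftrightarrow>
     (\<exists>(\<phi>::gtm fm) ps. set ps \<subseteq> S \<and>
        X = {xs. length xs = k \<and> set xs \<subseteq> S \<and> sat S (geval m) (env e (xs @ ps)) \<phi>})"

text \<open>The group (S, m) interprets (N,+,*) with parameters: there are n and a surjection f
  from a subset D of S^n onto N such that the preimage under f^k of every parameter-free
  definable subset of N^k is definable with parameters in the group (tuples of n-tuples are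
  identified with (n*k)-tuples by concatenation).\<close>
definition interprets_arith_params :: "'a set \<Rightarrow> ('a \<Rightarrow> 'a \<Rightarrow> 'a) \<Rightarrow> 'a \<Rightarrow> bool" where
  "interprets_arith_params S m e \<longleftrightarrow>
     (\<exists>(n::nat) (D::'a list set) (f::'a list \<Rightarrow> nat).
        D \<subseteq> {xs. length xs = n \<and> set xs \<subseteq> S} \<and> f ` D = UNIV \<and>
        (\<forall>k X. arith_definable k X \<longrightarrow>
           grp_definable_params S m e (n * k)
             {concat xss | xss. length xss = k \<and> set xss \<subseteq> D \<and> map f xss \<in> X}))"

end

theory Submission
  imports Defs
begin

text \<open>Choose three parameters in the group \<open>F(r,\<Lambda>,A) \<subseteq> G\<close>: a map \<open>t\<close> without fixed points in \<open>(0,r)\<close>,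
  a map \<open>a\<close> whose support is the fundamental domain \<open>(e, t e)\<close> of \<open>t\<close>, and a map \<open>u\<close> with support
  \<open>(0,e)\<close>. The breakpoints of \<open>t\<close> are chosen so that its centralizer in \<open>G\<close> is \<open>{t\<^sup>n}\<close>; among these
  powers the ones with \<open>n \<ge> 0\<close> are those for which the conjugate of \<open>a\<close> by \<open>t\<^sup>n\<close> commutes with \<open>u\<close>.
  Elements of \<open>G\<close> commuting with all conjugates \<open>a\<^sub>i\<close> of \<open>a\<close> by powers of \<open>t\<close> preserve every fundamental
  domain; being affine near \<open>0\<close> and near \<open>r\<close> they are the identity on all but finitely many of
  them. Hence, as in the wreath product of two infinite cyclic groups, the equation \<open>[b, t\<^sup>m] = [a, t\<^sup>n]\<close> has such
  a solution \<open>b\<close> iff \<open>m\<close> divides \<open>n\<close>. Finally, multiplication on \<open>\<nat>\<close> is definable from addition and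
  divisibility.\<close>

section \<open>Arithmetic from addition and divisibility\<close>

definition FImp :: "'t fm \<Rightarrow> 't fm \<Rightarrow> 't fm" where
  "FImp \<phi> \<psi> = FNot (FAnd \<phi> (FNot \<psi>))"

definition FAll :: "nat \<Rightarrow> 't fm \<Rightarrow> 't fm" where
  "FAll i \<phi> = FNot (FEx i (FNot \<phi>))"

lemma sat_FImp [simp]: "sat D ev g (FImp \<phi> \<psi>) \<longleftrightarrow> (sat D ev g \<phi> \<longrightarrow> sat D ev g \<psi>)"
  by (simp add: FImp_def)

lemma sat_FAll [simp]: "sat D ev g (FAll i \<phi>) \<longleftrightarrow> (\<forall>x\<in>D. sat D ev (g(i := x)) \<phi>)"
  by (simp add: FAll_def)

fun conj_upto :: "(nat \<Rightarrow> 't fm) \<Rightarrow> 't fm \<Rightarrow> nat \<Rightarrow> 't fm" where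
  "conj_upto \<Phi> \<psi> 0 = \<psi>"
| "conj_upto \<Phi> \<psi> (Suc k) = FAnd (\<Phi> k) (conj_upto \<Phi> \<psi> k)"

lemma sat_conj_upto:
  "sat D ev g (conj_upto \<Phi> \<psi> k) \<longleftrightarrow> (\<forall>i<k. sat D ev g (\<Phi> i)) \<and> sat D ev g \<psi>"
  by (induction k) (auto simp: less_Suc_eq)

section \<open>Relations of the group that encode natural numbers, divisibility and multiplication,
  with their formulas\<close>

definition mul_eq :: "nat \<Rightarrow> nat \<Rightarrow> nat \<Rightarrow> nat \<Rightarrow> gtm fm" where
  "mul_eq x y z w = FEq (GMul (GVar x) (GVar y)) (GMul (GVar z) (GVar w))"

lemma sat_mul_eq [simp]:
  "sat S (geval m) g (mul_eq x y z w) \<longleftrightarrow> m (g x) (g y) = m (g z) (g w)"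
  by (simp add: mul_eq_def)

text \<open>\<open>x\<close> is the conjugate of \<open>a\<close> by \<open>h\<close>, given by an
  equation because the language has no symbol for inverses. In the intended group, commuting with
  \<open>t\<close> makes \<open>h\<close> a power of \<open>t\<close>, and the condition on
  \<open>u\<close> selects the exponents \<ge> 0.\<close>

definition is_nat :: "'a set \<Rightarrow> ('a \<Rightarrow> 'a \<Rightarrow> 'a) \<Rightarrow> 'a \<Rightarrow> 'a \<Rightarrow> 'a \<Rightarrow> 'a \<Rightarrow> bool" where
  "is_nat S m t a u h \<longleftrightarrow>
     m h t = m t h \<and> (\<exists>x\<in>S. m h x = m a h \<and> m x u = m u x)"

text \<open>Named after the base of a wreath product: the conjugates of \<open>a\<close> by powers
  of \<open>t\<close> generate the base, and \<open>b\<close> is required to centralize it. The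
  elements \<open>h\<close> commuting with \<open>t\<close> stand for these powers.\<close>

definition in_base :: "'a set \<Rightarrow> ('a \<Rightarrow> 'a \<Rightarrow> 'a) \<Rightarrow> 'a \<Rightarrow> 'a \<Rightarrow> 'a \<Rightarrow> bool" where
  "in_base S m t a b \<longleftrightarrow>
     (\<forall>h\<in>S. m h t = m t h \<longrightarrow> (\<forall>x\<in>S. m h x = m a h \<longrightarrow> m x b = m b x))"

text \<open>The commutator equation \<open>[b, h] = [a, k]\<close>, written without inverses by means of the conjugates
  \<open>y\<close> of \<open>b\<close> and \<open>z\<close> of \<open>a\<close>.\<close>

definition divides :: "'a set \<Rightarrow> ('a \<Rightarrow> 'a \<Rightarrow> 'a) \<Rightarrow> 'a \<Rightarrow> 'a \<Rightarrow> 'a \<Rightarrow> 'a \<Rightarrow> bool" where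
  "divides S m t a h k \<longleftrightarrow>
     (\<exists>b\<in>S. in_base S m t a b \<and>
       (\<exists>y\<in>S. \<exists>z\<in>S. m h y = m b h \<and> m k z = m a k \<and> m a y = m b z))"

text \<open>The square of \<open>x\<close> is characterised by \<open>x\<^sup>2 + x = lcm x (x + 1)\<close>.\<close>

definition is_square :: "'a set \<Rightarrow> ('a \<Rightarrow> 'a \<Rightarrow> 'a) \<Rightarrow> 'a \<Rightarrow> 'a \<Rightarrow> 'a \<Rightarrow> 'a \<Rightarrow> 'a \<Rightarrow> bool" where
  "is_square S m t a u x y \<longleftrightarrow> is_nat S m t a u y \<and>
     (\<exists>p\<in>S. \<exists>q\<in>S. p = m y x \<and> q = m x t \<and>
       (\<forall>w\<in>S. is_nat S m t a u w \<longrightarrow>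
          (divides S m t a p w \<longrightarrow> divides S m t a x w \<and> divides S m t a q w) \<and>
          (divides S m t a x w \<and> divides S m t a q w \<longrightarrow> divides S m t a p w)))"

text \<open>Polarization: (x + y)^2 = x^2 + y^2 + 2z holds exactly for z = xy. Addition of exponents
  is the group multiplication.\<close>

definition is_product :: "'a set \<Rightarrow> ('a \<Rightarrow> 'a \<Rightarrow> 'a) \<Rightarrow> 'a \<Rightarrow> 'a \<Rightarrow> 'a \<Rightarrow> 'a \<Rightarrow> 'a \<Rightarrow> 'a \<Rightarrow> bool" where
  "is_product S m t a u x y z \<longleftrightarrow> is_nat S m t a u z \<and>
     (\<exists>p\<in>S. \<exists>q\<in>S. \<exists>s\<in>S. \<exists>w\<in>S. w = m x y \<and> is_square S m t a u x p \<and>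
        is_square S m t a u y q \<and> is_square S m t a u w s \<and> s = m (m p q) (m z z))"

text \<open>In the formulas below \<open>v\<close> exceeds all free variables, and all variables \<open>\<ge> v\<close> are available for quantification.\<close>

definition is_nat_fm :: "nat \<Rightarrow> nat \<Rightarrow> nat \<Rightarrow> nat \<Rightarrow> nat \<Rightarrow> gtm fm" where
  "is_nat_fm t a u h v =
     FAnd (mul_eq h t t h) (FEx v (FAnd (mul_eq h v a h) (mul_eq v u u v)))"

definition in_base_fm :: "nat \<Rightarrow> nat \<Rightarrow> nat \<Rightarrow> nat \<Rightarrow> gtm fm" where
  "in_base_fm t a b v =
     FAll v (FImp (mul_eq v t t v)
       (FAll (v + 1) (FImp (mul_eq v (v + 1) a v) (mul_eq (v + 1) b b (v + 1)))))"

definition divides_fm :: "nat \<Rightarrow> nat \<Rightarrow> nat \<Rightarrow> nat \<Rightarrow> nat \<Rightarrow> gtm fm" where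
  "divides_fm t a h k v =
     FEx v (FAnd (in_base_fm t a v (v + 1))
       (FEx (v + 1) (FEx (v + 2)
         (FAnd (mul_eq h (v + 1) v h)
           (FAnd (mul_eq k (v + 2) a k) (mul_eq a (v + 1) v (v + 2)))))))"

definition is_square_fm :: "nat \<Rightarrow> nat \<Rightarrow> nat \<Rightarrow> nat \<Rightarrow> nat \<Rightarrow> nat \<Rightarrow> gtm fm" where
  "is_square_fm t a u x y v = FAnd (is_nat_fm t a u y v)
     (FEx v (FEx (v + 1)
       (FAnd (FEq (GVar v) (GMul (GVar y) (GVar x)))
         (FAnd (FEq (GVar (v + 1)) (GMul (GVar x) (GVar t)))
           (FAll (v + 2) (FImp (is_nat_fm t a u (v + 2) (v + 3))
             (FAnd
               (FImp (divides_fm t a v (v + 2) (v + 3))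
                 (FAnd (divides_fm t a x (v + 2) (v + 3)) (divides_fm t a (v + 1) (v + 2) (v + 3))))
               (FImp (FAnd (divides_fm t a x (v + 2) (v + 3)) (divides_fm t a (v + 1) (v + 2) (v + 3)))
                 (divides_fm t a v (v + 2) (v + 3))))))))))"

definition is_product_fm :: "nat \<Rightarrow> nat \<Rightarrow> nat \<Rightarrow> nat \<Rightarrow> nat \<Rightarrow> nat \<Rightarrow> nat \<Rightarrow> gtm fm" where
  "is_product_fm t a u x y z v = FAnd (is_nat_fm t a u z v)
     (FEx v (FEx (v + 1) (FEx (v + 2) (FEx (v + 3)
       (FAnd (FEq (GVar (v + 3)) (GMul (GVar x) (GVar y)))
         (FAnd (is_square_fm t a u x v (v + 4))
           (FAnd (is_square_fm t a u y (v + 1) (v + 4))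
             (FAnd (is_square_fm t a u (v + 3) (v + 2) (v + 4))
               (FEq (GVar (v + 2))
                 (GMul (GMul (GVar v) (GVar (v + 1))) (GMul (GVar z) (GVar z))))))))))))"

lemma sat_is_nat_fm [simp]:
  assumes "t < v" "a < v" "u < v" "h < v"
  shows "sat S (geval m) g (is_nat_fm t a u h v) \<longleftrightarrow> is_nat S m (g t) (g a) (g u) (g h)"
  using assms by (simp add: is_nat_fm_def is_nat_def)

lemma sat_in_base_fm [simp]:
  assumes "t < v" "a < v" "b < v"
  shows "sat S (geval m) g (in_base_fm t a b v) \<longleftrightarrow> in_base S m (g t) (g a) (g b)"
  using assms by (simp add: in_base_fm_def in_base_def)

lemma sat_divides_fm [simp]:
  assumes "t < v" "a < v" "h < v" "k < v"
  shows "sat S (geval m) g (divides_fm t a h k v) \<longleftrightarrow> divides S m (g t) (g a) (g h) (g k)"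
  using assms by (simp add: divides_fm_def divides_def)

lemma sat_is_square_fm [simp]:
  assumes "t < v" "a < v" "u < v" "x < v" "y < v"
  shows "sat S (geval m) g (is_square_fm t a u x y v) \<longleftrightarrow>
    is_square S m (g t) (g a) (g u) (g x) (g y)"
  using assms by (simp add: is_square_fm_def is_square_def)

lemma sat_is_product_fm [simp]:
  assumes "t < v" "a < v" "u < v" "x < v" "y < v" "z < v"
  shows "sat S (geval m) g (is_product_fm t a u x y z v) \<longleftrightarrow>
    is_product S m (g t) (g a) (g u) (g x) (g y) (g z)"
  using assms by (simp add: is_product_fm_def is_product_def)

section \<open>Translation of arithmetic formulas into group formulas\<close>

fun atm_bound :: "atm \<Rightarrow> nat" where
  "atm_bound (AVar i) = Suc i"
| "atm_bound (APlus p q) = max (atm_bound p) (atm_bound q)"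
| "atm_bound (ATimes p q) = max (atm_bound p) (atm_bound q)"

fun fm_bound :: "atm fm \<Rightarrow> nat" where
  "fm_bound (FEq p q) = max (atm_bound p) (atm_bound q)"
| "fm_bound (FNot \<phi>) = fm_bound \<phi>"
| "fm_bound (FAnd \<phi> \<psi>) = max (fm_bound \<phi>) (fm_bound \<psi>)"
| "fm_bound (FEx i \<phi>) = max (Suc i) (fm_bound \<phi>)"

text \<open>The variables \<open>k\<close>, \<open>k + 1\<close>, \<open>k + 2\<close> are reserved for the parameters.\<close>

definition shift_var :: "nat \<Rightarrow> nat \<Rightarrow> nat" where
  "shift_var k i = (if i < k then i else i + 3)"

lemma shift_var_inj: "shift_var k i = shift_var k j \<longleftrightarrow> i = j"
  by (auto simp: shift_var_def)

text \<open>A sum becomes a product in the group, but multiplication is only a definable relation.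
  Terms are therefore translated into formulas forcing the variable \<open>w\<close> to hold the
  code of the value. The intermediate quantifiers range over the whole group; the subformulas
  themselves confine the witnesses to codes.\<close>

fun value_fm :: "nat \<Rightarrow> atm \<Rightarrow> nat \<Rightarrow> nat \<Rightarrow> gtm fm" where
  "value_fm k (AVar i) w v = FEq (GVar w) (GVar (shift_var k i))"
| "value_fm k (APlus p q) w v =
     FEx v (FEx (v + 1) (FAnd (value_fm k p v (v + 2)) (FAnd (value_fm k q (v + 1) (v + 2))
       (FEq (GVar w) (GMul (GVar v) (GVar (v + 1)))))))"
| "value_fm k (ATimes p q) w v =
     FEx v (FEx (v + 1) (FAnd (value_fm k p v (v + 2)) (FAnd (value_fm k q (v + 1) (v + 2))
       (is_product_fm k (k + 1) (k + 2) v (v + 1) w (v + 2)))))"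

text \<open>Quantifiers are relativized to codes of natural numbers. The bound \<open>v\<close>
  stays the same throughout: it is meant to exceed every shifted variable of the formula, so that
  auxiliary variables never capture one of them.\<close>

fun arith_to_grp :: "nat \<Rightarrow> nat \<Rightarrow> atm fm \<Rightarrow> gtm fm" where
  "arith_to_grp k v (FEq p q) =
     FEx v (FAnd (value_fm k p v (v + 1)) (value_fm k q v (v + 1)))"
| "arith_to_grp k v (FNot \<phi>) = FNot (arith_to_grp k v \<phi>)"
| "arith_to_grp k v (FAnd \<phi> \<psi>) = FAnd (arith_to_grp k v \<phi>) (arith_to_grp k v \<psi>)"
| "arith_to_grp k v (FEx i \<phi>) = FEx (shift_var k i)
     (FAnd (is_nat_fm k (k + 1) (k + 2) (shift_var k i) v) (arith_to_grp k v \<phi>))"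

section \<open>Groups in which coded numbers carry addition and divisibility\<close>

locale divisibility_model =
  fixes S :: "'a set" and m :: "'a \<Rightarrow> 'a \<Rightarrow> 'a" and e t a u :: 'a and \<tau> :: "nat \<Rightarrow> 'a"
  assumes params: "t \<in> S" "a \<in> S" "u \<in> S"
    and \<tau>_in: "\<tau> n \<in> S"
    and \<tau>_inj: "inj \<tau>"
    and \<tau>_0: "\<tau> 0 = e"
    and \<tau>_1: "\<tau> 1 = t"
    and \<tau>_add: "\<tau> (i + j) = m (\<tau> i) (\<tau> j)"
    and is_nat_iff: "h \<in> S \<Longrightarrow> is_nat S m t a u h \<longleftrightarrow> h \<in> range \<tau>"
    and divides_iff: "divides S m t a (\<tau> i) (\<tau> j) \<longleftrightarrow> i dvd j"
begin

text \<open>As i and i + 1 are coprime, their common multiples are the multiples of i (i + 1). A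
  natural number is determined by its multiples, so the condition on \<open>\<tau> j\<close> amounts
  to j + i = i (i + 1).\<close>

lemma is_square_iff:
  assumes "y \<in> S"
  shows "is_square S m t a u (\<tau> i) y \<longleftrightarrow> y = \<tau> (i * i)"
proof -
  have key: "(\<forall>w. (j + i) dvd w \<longleftrightarrow> i dvd w \<and> (i + 1) dvd w) \<longleftrightarrow> j = i * i" for j
  proof -
    have "coprime i (i + 1)" by simp
    then have *: "i dvd w \<and> (i + 1) dvd w \<longleftrightarrow> i * (i + 1) dvd w" for w
      by (metis divides_mult dvd_mult_left dvd_mult_right)
    have "(\<forall>w. (j + i) dvd w \<longleftrightarrow> i * (i + 1) dvd w) \<longleftrightarrow> j + i = i * (i + 1)"
      by (metis dvd_antisym dvd_refl)
    then show ?thesis unfolding * by auto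
  qed
  have eq: "m (\<tau> j) (\<tau> i) = \<tau> (j + i)" "m (\<tau> i) t = \<tau> (i + 1)" for j
    using \<tau>_add \<tau>_1 by metis+
  have "is_square S m t a u (\<tau> i) (\<tau> j) \<longleftrightarrow> (\<forall>w. (j + i) dvd w \<longleftrightarrow> i dvd w \<and> (i + 1) dvd w)" for j
  proof -
    have "is_nat S m t a u (\<tau> j)" using is_nat_iff \<tau>_in by blast
    then have "is_square S m t a u (\<tau> i) (\<tau> j) \<longleftrightarrow>
      (\<forall>w\<in>S. is_nat S m t a u w \<longrightarrow>
        (divides S m t a (\<tau> (j + i)) w \<longleftrightarrow> divides S m t a (\<tau> i) w \<and> divides S m t a (\<tau> (i + 1)) w))"
      (is "?L \<longleftrightarrow> (\<forall>w\<in>S. ?N w \<longrightarrow> (?P w \<longleftrightarrow> ?Q w))")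
    proof -
      have "?L \<longleftrightarrow> (\<exists>p\<in>S. \<exists>q\<in>S. p = \<tau> (j + i) \<and> q = \<tau> (i + 1) \<and>
          (\<forall>w\<in>S. ?N w \<longrightarrow> (?P w \<longrightarrow> ?Q w) \<and> (?Q w \<longrightarrow> ?P w)))"
        using \<open>?N (\<tau> j)\<close> unfolding is_square_def eq by fast
      also have "\<dots> \<longleftrightarrow> (\<forall>w\<in>S. ?N w \<longrightarrow> (?P w \<longrightarrow> ?Q w) \<and> (?Q w \<longrightarrow> ?P w))"
        using \<tau>_in by fast
      finally show ?thesis by fast
    qed
    also have "\<dots> \<longleftrightarrow> (\<forall>w. divides S m t a (\<tau> (j + i)) (\<tau> w) \<longleftrightarrow>
        divides S m t a (\<tau> i) (\<tau> w) \<and> divides S m t a (\<tau> (i + 1)) (\<tau> w))"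
      using is_nat_iff \<tau>_in by (blast elim: rangeE)
    also have "\<dots> \<longleftrightarrow> (\<forall>w. (j + i) dvd w \<longleftrightarrow> i dvd w \<and> (i + 1) dvd w)"
      unfolding divides_iff ..
    finally show ?thesis .
  qed
  then have "is_square S m t a u (\<tau> i) (\<tau> j) \<longleftrightarrow> j = i * i" for j
    using key by blast
  moreover have "is_square S m t a u (\<tau> i) y \<Longrightarrow> y \<in> range \<tau>"
    using is_nat_iff assms by (auto simp: is_square_def)
  ultimately show ?thesis by (metis rangeE)
qed

lemma is_product_iff:
  assumes "z \<in> S"
  shows "is_product S m t a u (\<tau> i) (\<tau> j) z \<longleftrightarrow> z = \<tau> (i * j)"
proof -
  have "is_product S m t a u (\<tau> i) (\<tau> j) (\<tau> k) \<longleftrightarrow> k = i * j" for k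
  proof -
    have "is_product S m t a u (\<tau> i) (\<tau> j) (\<tau> k) \<longleftrightarrow>
      is_square S m t a u (\<tau> (i + j)) (\<tau> (i * i + j * j + (k + k)))" (is "?L \<longleftrightarrow> ?R")
    proof
      assume ?L
      then show ?R
        unfolding is_product_def by (metis \<tau>_add is_square_iff)
    next
      assume ?R
      then show ?L
        unfolding is_product_def
        by (metis \<tau>_add \<tau>_in is_nat_iff is_square_iff rangeI)
    qed
    also have "\<dots> \<longleftrightarrow> \<tau> (i * i + j * j + (k + k)) = \<tau> ((i + j) * (i + j))"
      by (rule is_square_iff[OF \<tau>_in])
    also have "\<dots> \<longleftrightarrow> i * i + j * j + (k + k) = (i + j) * (i + j)"
      using \<tau>_inj by (simp add: inj_eq)
    also have "\<dots> \<longleftrightarrow> k = i * j" by (auto simp: algebra_simps)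
    finally show ?thesis .
  qed
  moreover have "is_product S m t a u (\<tau> i) (\<tau> j) z \<Longrightarrow> z \<in> range \<tau>"
    using is_nat_iff assms by (auto simp: is_product_def)
  ultimately show ?thesis by (metis rangeE)
qed

lemma sat_value_fm:
  assumes "\<And>i. i < atm_bound p \<Longrightarrow> shift_var k i < v \<and> g (shift_var k i) = \<tau> (c i)"
    and "w < v" "k + 2 < v" "g k = t" "g (k + 1) = a" "g (k + 2) = u" "g w \<in> S"
  shows "sat S (geval m) g (value_fm k p w v) \<longleftrightarrow> g w = \<tau> (aeval c p)"
  using assms
proof (induction p arbitrary: g w v)
  case (AVar i)
  then show ?case by simp
next
  case (APlus p q)
  have sub: "sat S (geval m) (g(v := x, v + 1 := y)) (value_fm k p v (v + 2)) \<longleftrightarrow> x = \<tau> (aeval c p)"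
    "sat S (geval m) (g(v := x, v + 1 := y)) (value_fm k q (v + 1) (v + 2)) \<longleftrightarrow> y = \<tau> (aeval c q)"
    if "x \<in> S" "y \<in> S" for x y
  proof -
    define g' where "g' = g(v := x, v + 1 := y)"
    have old: "g' i = g i" if "i < v" for i using that by (simp add: g'_def)
    have sv: "shift_var k i < v + 2 \<and> g' (shift_var k i) = \<tau> (c i)"
      if "i < atm_bound p \<or> i < atm_bound q" for i
      using APlus.prems(1)[of i] that old by fastforce
    have gv: "g' v = x" "g' (v + 1) = y" by (simp_all add: g'_def)
    have par: "k + 2 < v + 2" "g' k = t" "g' (k + 1) = a" "g' (k + 2) = u"
      using APlus.prems old by auto
    show "sat S (geval m) (g(v := x, v + 1 := y)) (value_fm k p v (v + 2)) \<longleftrightarrow> x = \<tau> (aeval c p)"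
      unfolding g'_def[symmetric] using APlus.IH(1)[of "v + 2" g' v, OF sv _ par] that gv by simp
    show "sat S (geval m) (g(v := x, v + 1 := y)) (value_fm k q (v + 1) (v + 2)) \<longleftrightarrow> y = \<tau> (aeval c q)"
      unfolding g'_def[symmetric] using APlus.IH(2)[of "v + 2" g' "v + 1", OF sv _ par] that gv by simp
  qed
  show ?case using APlus.prems \<tau>_in by (auto simp: sub[simplified] \<tau>_add)
next
  case (ATimes p q)
  have sub: "sat S (geval m) (g(v := x, v + 1 := y)) (value_fm k p v (v + 2)) \<longleftrightarrow> x = \<tau> (aeval c p)"
    "sat S (geval m) (g(v := x, v + 1 := y)) (value_fm k q (v + 1) (v + 2)) \<longleftrightarrow> y = \<tau> (aeval c q)"
    if "x \<in> S" "y \<in> S" for x y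
  proof -
    define g' where "g' = g(v := x, v + 1 := y)"
    have old: "g' i = g i" if "i < v" for i using that by (simp add: g'_def)
    have sv: "shift_var k i < v + 2 \<and> g' (shift_var k i) = \<tau> (c i)"
      if "i < atm_bound p \<or> i < atm_bound q" for i
      using ATimes.prems(1)[of i] that old by fastforce
    have gv: "g' v = x" "g' (v + 1) = y" by (simp_all add: g'_def)
    have par: "k + 2 < v + 2" "g' k = t" "g' (k + 1) = a" "g' (k + 2) = u"
      using ATimes.prems old by auto
    show "sat S (geval m) (g(v := x, v + 1 := y)) (value_fm k p v (v + 2)) \<longleftrightarrow> x = \<tau> (aeval c p)"
      unfolding g'_def[symmetric] using ATimes.IH(1)[of "v + 2" g' v, OF sv _ par] that gv by simp
    show "sat S (geval m) (g(v := x, v + 1 := y)) (value_fm k q (v + 1) (v + 2)) \<longleftrightarrow> y = \<tau> (aeval c q)"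
      unfolding g'_def[symmetric] using ATimes.IH(2)[of "v + 2" g' "v + 1", OF sv _ par] that gv by simp
  qed
  show ?case using ATimes.prems \<tau>_in by (auto simp: sub[simplified] is_product_iff)
qed

lemma sat_arith_to_grp:
  assumes "fm_bound \<phi> + k + 3 \<le> v" "\<And>i. g (shift_var k i) = \<tau> (c i)"
    "g k = t" "g (k + 1) = a" "g (k + 2) = u"
  shows "sat S (geval m) g (arith_to_grp k v \<phi>) \<longleftrightarrow> sat UNIV aeval c \<phi>"
  using assms
proof (induction \<phi> arbitrary: g c)
  case (FEq p q)
  have sv: "shift_var k i < v" if "i < fm_bound (FEq p q)" for i
    using FEq.prems(1) that by (auto simp: shift_var_def)
  have "sat S (geval m) (g(v := x)) (value_fm k s v (v + 1)) \<longleftrightarrow> x = \<tau> (aeval c s)"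
    if "x \<in> S" "s = p \<or> s = q" for x s
  proof -
    have "sat S (geval m) (g(v := x)) (value_fm k s v (v + 1)) \<longleftrightarrow> (g(v := x)) v = \<tau> (aeval c s)"
    proof (rule sat_value_fm)
      fix i assume "i < atm_bound s"
      then have "shift_var k i < v" using sv[of i] that by auto
      then show "shift_var k i < v + 1 \<and> (g(v := x)) (shift_var k i) = \<tau> (c i)"
        using FEq.prems(2) by simp
    qed (use FEq.prems that in auto)
    then show ?thesis by simp
  qed
  then show ?case using \<tau>_in \<tau>_inj by (auto simp: inj_eq)
next
  case (FEx i \<phi>)
  have sv: "shift_var k i < v" "shift_var k i \<noteq> k" "shift_var k i \<noteq> k + 1" "shift_var k i \<noteq> k + 2"
    using FEx.prems(1) by (auto simp: shift_var_def)
  have "sat S (geval m) g (arith_to_grp k v (FEx i \<phi>)) \<longleftrightarrow>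
      (\<exists>x\<in>S. x \<in> range \<tau> \<and> sat S (geval m) (g(shift_var k i := x)) (arith_to_grp k v \<phi>))"
    using sv FEx.prems by (simp add: is_nat_iff cong: bex_cong conj_cong)
  also have "\<dots> \<longleftrightarrow> (\<exists>n. sat S (geval m) (g(shift_var k i := \<tau> n)) (arith_to_grp k v \<phi>))"
    using \<tau>_in by blast
  also have "\<dots> \<longleftrightarrow> (\<exists>n. sat UNIV aeval (c(i := n)) \<phi>)"
  proof -
    have "sat S (geval m) (g(shift_var k i := \<tau> n)) (arith_to_grp k v \<phi>) \<longleftrightarrow>
        sat UNIV aeval (c(i := n)) \<phi>" for n
      by (rule FEx.IH) (use FEx.prems sv in \<open>auto simp: shift_var_inj\<close>)
    then show ?thesis by simp
  qed
  finally show ?case by simp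
qed simp_all

theorem interprets_arith: "interprets_arith_params S m e"
proof -
  \<comment> \<open>The interpretation is one-dimensional: the singleton list
    \<open>[\<tau> n]\<close> codes n.\<close>
  define D where "D = (\<lambda>x. [x]) ` range \<tau>"
  define f where "f xs = the_inv \<tau> (hd xs)" for xs
  have f\<tau>: "f [\<tau> n] = n" for n by (simp add: f_def \<tau>_inj the_inv_f_f)
  have fD: "f ` D = UNIV"
    using f\<tau> by (auto simp: D_def image_image intro!: image_eqI)
  have "grp_definable_params S m e (1 * k)
          {concat xss | xss. length xss = k \<and> set xss \<subseteq> D \<and> map f xss \<in> X}"
    if X: "arith_definable k X" for k X
  proof -
    obtain \<phi> where \<phi>: "X = {ns. length ns = k \<and> sat UNIV aeval (env 0 ns) \<phi>}"
      using X by (auto simp: arith_definable_def)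
    define v where "v = fm_bound \<phi> + k + 3"
    \<comment> \<open>Besides the translation of \<phi>, the formula has to reject tuples with an
      entry that is not a code; hence one conjunct for each of the k free variables.\<close>
    define \<psi> where "\<psi> = conj_upto (\<lambda>i. is_nat_fm k (k + 1) (k + 2) i v) (arith_to_grp k v \<phi>) k"
    have pre: "{concat xss | xss. length xss = k \<and> set xss \<subseteq> D \<and> map f xss \<in> X} =
      {map \<tau> ns | ns. ns \<in> X}" (is "?L = ?R")
    proof (intro equalityI subsetI)
      fix xs assume "xs \<in> ?L"
      then obtain xss where xss: "xs = concat xss" "length xss = k" "set xss \<subseteq> D" "map f xss \<in> X"
        by blast
      have "concat xss = map \<tau> (map f xss)"
        using xss(3) f\<tau> by (induction xss) (auto simp: D_def)
      then show "xs \<in> ?R" using xss by blast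
    next
      fix xs assume "xs \<in> ?R"
      then obtain ns where ns: "xs = map \<tau> ns" "ns \<in> X" by blast
      have "concat (map (\<lambda>n. [\<tau> n]) ns) = xs" "map f (map (\<lambda>n. [\<tau> n]) ns) = ns"
        using ns f\<tau> by (simp_all add: comp_def)
      moreover have "length ns = k" using ns \<phi> by simp
      ultimately show "xs \<in> ?L" using ns(2)
        by (intro CollectI exI[of _ "map (\<lambda>n. [\<tau> n]) ns"]) (auto simp: D_def)
    qed
    have sat: "sat S (geval m) (env e (xs @ [t, a, u])) \<psi> \<longleftrightarrow> (\<exists>ns\<in>X. xs = map \<tau> ns)"
      if xs: "length xs = k" "set xs \<subseteq> S" for xs
    proof -
      define g where "g = env e (xs @ [t, a, u])"
      have g: "g k = t" "g (k + 1) = a" "g (k + 2) = u" "\<And>i. i < k \<Longrightarrow> g i = xs ! i"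
        "\<And>i. i \<ge> k + 3 \<Longrightarrow> g i = e"
        using xs by (auto simp: g_def env_def nth_append)
      have nat: "sat S (geval m) g (is_nat_fm k (k + 1) (k + 2) i v) \<longleftrightarrow> xs ! i \<in> range \<tau>"
        if "i < k" for i
        using that g xs is_nat_iff by (simp add: v_def subset_iff)
      have *: "sat S (geval m) g (arith_to_grp k v \<phi>) \<longleftrightarrow> ns \<in> X" if "xs = map \<tau> ns" for ns
      proof -
        \<comment> \<open>For i \<ge> k the shifted variable lies beyond the three parameters and
          has the default value \<open>e = \<tau> 0\<close>, which codes the default value 0 on the
          arithmetic side.\<close>
        have "g (shift_var k i) = \<tau> (env 0 ns i)" for i
          using that g xs \<tau>_0 by (auto simp: shift_var_def env_def)
        then have "sat S (geval m) g (arith_to_grp k v \<phi>) \<longleftrightarrow> sat UNIV aeval (env 0 ns) \<phi>"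
          by (intro sat_arith_to_grp) (use g in \<open>auto simp: v_def\<close>)
        then show ?thesis using that xs \<phi> by auto
      qed
      have "(\<forall>i<k. xs ! i \<in> range \<tau>) \<longleftrightarrow> set xs \<subseteq> range \<tau>"
        using xs by (force simp: in_set_conv_nth subset_iff)
      also have "\<dots> \<longleftrightarrow> (\<exists>ns. xs = map \<tau> ns)" unfolding ex_map_conv by auto
      finally have "(\<forall>i<k. xs ! i \<in> range \<tau>) \<longleftrightarrow> (\<exists>ns. xs = map \<tau> ns)" .
      then show ?thesis unfolding g_def[symmetric] \<psi>_def sat_conj_upto using nat * by blast
    qed
    have "{map \<tau> ns | ns. ns \<in> X} =
      {xs. length xs = k \<and> set xs \<subseteq> S \<and> (\<exists>ns\<in>X. xs = map \<tau> ns)}"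
      using \<phi> \<tau>_in by auto
    also have "\<dots> = {xs. length xs = k \<and> set xs \<subseteq> S \<and>
        sat S (geval m) (env e (xs @ [t, a, u])) \<psi>}"
      using sat by (intro Collect_cong) (simp cong: conj_cong)
    finally have "{map \<tau> ns | ns. ns \<in> X} = \<dots>" .
    then show ?thesis unfolding grp_definable_params_def pre
      using params by (intro exI[of _ \<psi>] exI[of _ "[t, a, u]"]) simp
  qed
  moreover have "D \<subseteq> {xs. length xs = 1 \<and> set xs \<subseteq> S}" using \<tau>_in by (auto simp: D_def)
  ultimately show ?thesis unfolding interprets_arith_params_def using fD by blast
qed

end

section \<open>Bumps and breakpoints\<close>

definition bump_on :: "(real \<Rightarrow> real) \<Rightarrow> real \<Rightarrow> real \<Rightarrow> bool" where
  "bump_on x p q \<longleftrightarrow> strict_mono x \<and> surj x \<and>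
     (\<forall>y. p < y \<and> y < q \<longrightarrow> y < x y) \<and> (\<forall>y. \<not> (p < y \<and> y < q) \<longrightarrow> x y = y)"

lemma bump_onD:
  assumes "bump_on x p q"
  shows "strict_mono x" "surj x" "bij x" "x y < x z \<longleftrightarrow> y < z"
    "p < y \<Longrightarrow> y < q \<Longrightarrow> y < x y" "\<not> (p < y \<and> y < q) \<Longrightarrow> x y = y"
    "x y = y \<longleftrightarrow> \<not> (p < y \<and> y < q)"
proof -
  show mono: "strict_mono x" and surj: "surj x"
    and up: "p < y \<Longrightarrow> y < q \<Longrightarrow> y < x y" and out: "\<not> (p < y \<and> y < q) \<Longrightarrow> x y = y"
    using assms by (auto simp: bump_on_def)
  show "bij x" using mono surj by (simp add: bij_def strict_mono_imp_inj_on)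
  show "x y < x z \<longleftrightarrow> y < z" by (rule strict_mono_less[OF mono])
  show "x y = y \<longleftrightarrow> \<not> (p < y \<and> y < q)" using up out by force
qed

text \<open>By injectivity \<open>x\<close> fixes \<open>x y\<close> iff it fixes \<open>y\<close>,
  and the points not fixed are exactly those between \<open>p\<close> and \<open>q\<close>.\<close>

lemma bump_on_range:
  assumes "bump_on x p q"
  shows "p < x y \<and> x y < q \<longleftrightarrow> p < y \<and> y < q"
proof -
  have "x (x y) = x y \<longleftrightarrow> x y = y"
    using bump_onD(3)[OF assms] by (metis bij_def injD)
  then show ?thesis using bump_onD(7)[OF assms] by metis
qed

lemma bump_on_commute:
  assumes x: "bump_on x p q" and y: "bump_on y p' q'" and "q \<le> p'"
  shows "x \<circ> y = y \<circ> x"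
proof
  fix z
  note D = bump_onD(6)[OF x] bump_onD(6)[OF y] bump_on_range[OF x, of z] bump_on_range[OF y, of z]
  consider "p < z \<and> z < q" | "p' < z \<and> z < q'" | "\<not> (p < z \<and> z < q)" "\<not> (p' < z \<and> z < q')"
    by blast
  then show "(x \<circ> y) z = (y \<circ> x) z"
    by cases (use D assms(3) in \<open>force\<close>)+
qed

lemma bump_on_conj:
  assumes f: "strict_mono f" "f \<circ> g = id" "g \<circ> f = id" and x: "bump_on x p q"
  shows "bump_on (f \<circ> x \<circ> g) (f p) (f q)"
proof -
  have fg: "f (g y) = y" "g (f y) = y" for y using f by (metis comp_apply id_apply)+
  have less: "f y < f z \<longleftrightarrow> y < z" for y z using f(1) by (rule strict_mono_less)
  have gless: "g y < g z \<longleftrightarrow> y < z" for y z using less[of "g y" "g z"] fg by simp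
  have "strict_mono (f \<circ> x \<circ> g)"
    using less gless bump_onD(4)[OF x] by (simp add: strict_mono_def)
  moreover have "surj (f \<circ> x \<circ> g)"
    using bump_onD(2)[OF x] fg by (metis comp_surj surjI)
  moreover have "(f p < y \<and> y < f q \<longrightarrow> y < (f \<circ> x \<circ> g) y) \<and>
      (\<not> (f p < y \<and> y < f q) \<longrightarrow> (f \<circ> x \<circ> g) y = y)" for y
  proof -
    have "f p < y \<and> y < f q \<longleftrightarrow> p < g y \<and> g y < q"
      using less[of p "g y"] less[of "g y" q] fg by simp
    moreover have "g y < x (g y) \<Longrightarrow> y < f (x (g y))"
      using less[of "g y" "x (g y)"] fg by simp
    ultimately show ?thesis using bump_onD(5,6)[OF x, of "g y"] fg by auto
  qed
  ultimately show ?thesis unfolding bump_on_def by blast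
qed

lemma bump_on_funpow:
  assumes x: "bump_on x p q"
  shows "(x ^^ k) y < (x ^^ k) z \<longleftrightarrow> y < z" "p < (x ^^ k) y \<and> (x ^^ k) y < q \<longleftrightarrow> p < y \<and> y < q"
    "y \<le> (x ^^ k) y"
proof -
  show "(x ^^ k) y < (x ^^ k) z \<longleftrightarrow> y < z" by (induction k) (simp_all add: bump_onD(4)[OF x])
  show "p < (x ^^ k) y \<and> (x ^^ k) y < q \<longleftrightarrow> p < y \<and> y < q"
    by (induction k) (simp_all add: bump_on_range[OF x])
  have "z \<le> x z" for z using bump_onD(5,6)[OF x, of z] by force
  then show "y \<le> (x ^^ k) y" by (induction k) (auto intro: order_trans)
qed

lemma bump_on_funpow_strict_mono:
  assumes x: "bump_on x p q" and y: "p < y" "y < q"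
  shows "strict_mono (\<lambda>k. (x ^^ k) y)"
  unfolding strict_mono_Suc_iff
proof
  fix k
  have "p < (x ^^ k) y" "(x ^^ k) y < q" using bump_on_funpow(2)[OF x, of k y] y by auto
  then show "(x ^^ k) y < (x ^^ Suc k) y" using bump_onD(5)[OF x] by simp
qed

text \<open>The supremum \<open>s\<close> of an orbit bounded by \<open>z\<close> would lie strictly
  between \<open>p\<close> and \<open>q\<close>. Its preimage \<open>w\<close> is smaller than
  \<open>s\<close>, so some orbit point exceeds \<open>w\<close>, and the next one exceeds
  \<open>s\<close>.\<close>

lemma bump_on_orbit_exceeds:
  assumes x: "bump_on x p q" and y: "p < y" "y < q" and z: "z < q"
  shows "\<exists>k. z < (x ^^ k) y"
proof (rule ccontr)
  assume "\<not> ?thesis"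
  then have le: "(x ^^ k) y \<le> z" for k by (simp add: not_less)
  define s where "s = (SUP k. (x ^^ k) y)"
  have bdd: "bdd_above (range (\<lambda>k. (x ^^ k) y))" using le by (intro bdd_aboveI[of _ z]) auto
  have s_le: "s \<le> z" unfolding s_def using le by (intro cSUP_least) auto
  have ys: "(x ^^ k) y \<le> s" for k unfolding s_def using bdd by (rule cSUP_upper2) auto
  have s: "p < s" "s < q" using ys[of 0] y s_le z by auto
  obtain w where w: "x w = s" using bump_onD(2)[OF x] by (metis surjD)
  then have "w < s" using bump_on_range[OF x, of w] bump_onD(5)[OF x, of w] s by auto
  then obtain k where "w < (x ^^ k) y"
    unfolding s_def using less_cSUP_iff[OF _ bdd] by auto
  then have "s < (x ^^ Suc k) y" using bump_onD(4)[OF x, of w] w by simp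
  then show False using ys[of "Suc k"] by simp
qed

text \<open>A map commuting with \<open>x\<close> permutes the fixed points of \<open>x\<close>,
  hence preserves the set of moved points. This is how commutation is turned into geometric
  information throughout.\<close>

lemma commute_bump_on_range:
  assumes x: "bump_on x p q" and g: "inj g" "g \<circ> x = x \<circ> g"
  shows "p < g y \<and> g y < q \<longleftrightarrow> p < y \<and> y < q"
proof -
  have "g (x y) = x (g y)" using g(2) by (metis comp_apply)
  then have "x (g y) = g y \<longleftrightarrow> x y = y" using g(1) by (metis injD)
  then show ?thesis using bump_onD(7)[OF x] by metis
qed

section \<open>Integer powers of a bijection\<close>

definition zpow :: "('a \<Rightarrow> 'a) \<Rightarrow> int \<Rightarrow> 'a \<Rightarrow> 'a" where
  "zpow f i = (if 0 \<le> i then f ^^ nat i else inv_into UNIV f ^^ nat (- i))"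

lemma zpow_of_nat [simp]: "zpow f (int n) = f ^^ n"
  by (simp add: zpow_def)

lemma zpow_0 [simp]: "zpow f 0 = id"
  by (simp add: zpow_def)

lemma zpow_1 [simp]: "zpow f 1 = f"
  by (simp add: zpow_def)

lemma zpow_succ:
  assumes "bij f"
  shows "zpow f (i + 1) = f \<circ> zpow f i"
proof (cases "0 \<le> i")
  case True
  then have "nat (i + 1) = Suc (nat i)" by simp
  then show ?thesis using True by (simp add: zpow_def)
next
  case False
  then have "nat (- i) = Suc (nat (- (i + 1)))" by simp
  then have "f \<circ> zpow f i = (f \<circ> inv_into UNIV f) \<circ> inv_into UNIV f ^^ nat (- (i + 1))"
    using False by (simp only: zpow_def funpow.simps(2) if_False comp_assoc)
  moreover have "f \<circ> inv_into UNIV f = id"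
    using assms by (simp add: bij_def surj_iff)
  moreover have "zpow f (i + 1) = inv_into UNIV f ^^ nat (- (i + 1))"
    using False by (cases "i = -1") (simp_all add: zpow_def)
  ultimately show ?thesis by simp
qed

lemma zpow_pred:
  assumes "bij f"
  shows "zpow f (i - 1) = inv_into UNIV f \<circ> zpow f i"
proof -
  have "inv_into UNIV f \<circ> zpow f i = (inv_into UNIV f \<circ> f) \<circ> zpow f (i - 1)"
    using zpow_succ[OF assms, of "i - 1"] by (simp add: comp_assoc)
  then show ?thesis using assms by (simp add: bij_def)
qed

lemma zpow_add:
  assumes "bij f"
  shows "zpow f (i + j) = zpow f i \<circ> zpow f j"
proof (induction i rule: int_induct[where k = 0])
  case (step1 i)
  have "zpow f (i + 1 + j) = f \<circ> zpow f (i + j)"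
    using zpow_succ[OF assms, of "i + j"] by (simp add: add_ac)
  then show ?case using step1 zpow_succ[OF assms, of i] by (simp add: comp_assoc)
next
  case (step2 i)
  have "zpow f (i - 1 + j) = inv_into UNIV f \<circ> zpow f (i + j)"
    using zpow_pred[OF assms, of "i + j"] by (simp add: algebra_simps)
  then show ?case using step2 zpow_pred[OF assms, of i] by (simp add: comp_assoc)
qed simp

lemma zpow_closed:
  assumes "bij f" "f \<in> G" "inv_into UNIV f \<in> G" "id \<in> G" "\<And>x y. x \<in> G \<Longrightarrow> y \<in> G \<Longrightarrow> x \<circ> y \<in> G"
  shows "zpow f i \<in> G"
proof (induction i rule: int_induct[where k = 0])
  case base
  show ?case using assms(4) by (metis zpow_0)
next
  case (step1 i)
  then show ?case using assms by (metis zpow_succ)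
next
  case (step2 i)
  then show ?case using assms by (metis zpow_pred)
qed

lemma commute_zpow:
  assumes "bij f" "h \<circ> f = f \<circ> h"
  shows "h \<circ> zpow f i = zpow f i \<circ> h"
proof (induction i rule: int_induct[where k = 0])
  case (step1 i)
  then show ?case using assms by (metis zpow_succ comp_assoc)
next
  case (step2 i)
  have "inv_into UNIV f \<circ> h = inv_into UNIV f \<circ> (h \<circ> f) \<circ> inv_into UNIV f"
    using assms(1) by (metis bij_def comp_assoc comp_id surj_iff)
  also have "\<dots> = h \<circ> inv_into UNIV f"
    using assms by (metis bij_def comp_assoc id_comp inv_o_cancel)
  finally show ?case using step2 assms(1) by (metis zpow_pred comp_assoc)
qed simp

text \<open>\<open>\<rho>\<close> is the right slope of \<open>f\<close> at \<open>x\<close> divided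
  by the left slope \<open>s\<close>; the two formulas also force continuity at \<open>x\<close>.
  The value is 1 where \<open>f\<close> is affine and differs from 1 at a genuine
  breakpoint.\<close>

definition jump :: "(real \<Rightarrow> real) \<Rightarrow> real \<Rightarrow> real \<Rightarrow> bool" where
  "jump f x \<rho> \<longleftrightarrow> (\<exists>\<delta>>0. \<exists>s>0. \<forall>v. 0 < v \<and> v < \<delta> \<longrightarrow>
     f (x + v) = f x + \<rho> * s * v \<and> f (x - v) = f x - s * v)"

lemma jumpI:
  assumes "0 < \<delta>" "0 < s" "\<And>v. 0 < v \<Longrightarrow> v < \<delta> \<Longrightarrow> f (x + v) = f x + \<rho> * s * v"
    "\<And>v. 0 < v \<Longrightarrow> v < \<delta> \<Longrightarrow> f (x - v) = f x - s * v"
  shows "jump f x \<rho>"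
  using assms unfolding jump_def by blast

lemma jump_unique:
  assumes "jump f x \<rho>" "jump f x \<sigma>"
  shows "\<rho> = \<sigma>"
proof -
  obtain \<delta> s where 1: "0 < \<delta>" "0 < s" "\<And>v. 0 < v \<and> v < \<delta> \<Longrightarrow>
     f (x + v) = f x + \<rho> * s * v \<and> f (x - v) = f x - s * v"
    using assms(1) unfolding jump_def by blast
  obtain \<delta>' s' where 2: "0 < \<delta>'" "0 < s'" "\<And>v. 0 < v \<and> v < \<delta>' \<Longrightarrow>
     f (x + v) = f x + \<sigma> * s' * v \<and> f (x - v) = f x - s' * v"
    using assms(2) unfolding jump_def by blast
  define v where "v = min \<delta> \<delta>' / 2"
  have v: "0 < v" "v < \<delta>" "v < \<delta>'" using 1 2 by (auto simp: v_def)
  have "s * v = s' * v" "\<rho> * s * v = \<sigma> * s' * v" using 1(3)[of v] 2(3)[of v] v by auto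
  then show ?thesis using v 1 2 by auto
qed

text \<open>The chain rule on either side of \<open>x\<close>. Since \<rho> > 0, points to the right
  of \<open>x\<close> go to the right of \<open>f x\<close>, so the two sides are not mixed.\<close>

lemma jump_comp:
  assumes "jump f x \<rho>" "jump g (f x) \<sigma>" "0 < \<rho>"
  shows "jump (g \<circ> f) x (\<rho> * \<sigma>)"
proof -
  obtain \<delta> s where 1: "0 < \<delta>" "0 < s" "\<And>v. 0 < v \<Longrightarrow> v < \<delta> \<Longrightarrow>
     f (x + v) = f x + \<rho> * s * v \<and> f (x - v) = f x - s * v"
    using assms(1) unfolding jump_def by blast
  obtain \<delta>' s' where 2: "0 < \<delta>'" "0 < s'" "\<And>v. 0 < v \<Longrightarrow> v < \<delta>' \<Longrightarrow>
     g (f x + v) = g (f x) + \<sigma> * s' * v \<and> g (f x - v) = g (f x) - s' * v"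
    using assms(2) unfolding jump_def by blast
  \<comment> \<open>Small enough that both increments, \<open>s * v\<close> and
    \<open>\<rho> * s * v\<close>, stay below \<open>\<delta>'\<close>.\<close>
  define d where "d = min \<delta> (min (\<delta>' / s) (\<delta>' / (\<rho> * s)))"
  have d: "0 < d" "v < d \<Longrightarrow> v < \<delta>" "v < d \<Longrightarrow> s * v < \<delta>'" "v < d \<Longrightarrow> \<rho> * s * v < \<delta>'" for v
    using 1(1,2) 2(1) assms(3) by (auto simp: d_def field_simps)
  show ?thesis
  proof (rule jumpI[of d "s * s'"])
    fix v assume v: "0 < v" "v < d"
    have "0 < s * v" "0 < \<rho> * s * v" using v 1 assms(3) by auto
    then show "(g \<circ> f) (x + v) = (g \<circ> f) x + \<rho> * \<sigma> * (s * s') * v"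
      "(g \<circ> f) (x - v) = (g \<circ> f) x - s * s' * v"
      using 1(3)[of v] 2(3)[of "s * v"] 2(3)[of "\<rho> * s * v"] v d by auto
  qed (use d 1 2 in auto)
qed

lemma jump_affine:
  assumes "\<And>y. lo < y \<Longrightarrow> y < hi \<Longrightarrow> f y = s * y + c" "0 < s" "lo < x" "x < hi"
  shows "jump f x 1"
proof (rule jumpI[of "min (x - lo) (hi - x)" s])
  fix v assume v: "0 < v" "v < min (x - lo) (hi - x)"
  show "f (x + v) = f x + 1 * s * v" "f (x - v) = f x - s * v"
    using v assms by (simp_all add: algebra_simps)
qed (use assms in auto)

lemma jump_funpow:
  assumes "\<And>y. y \<in> I \<Longrightarrow> f y \<in> I \<and> jump f y (j y)" "\<And>y. 0 < j y" "y \<in> I"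
  shows "jump (f ^^ N) y (\<Prod>i<N. j ((f ^^ i) y))"
proof -
  have I: "(f ^^ N) y \<in> I" for N by (induction N) (use assms in auto)
  show ?thesis
  proof (induction N)
    case 0
    show ?case by (rule jumpI[of 1 1]) auto
  next
    case (Suc N)
    have "jump (f \<circ> f ^^ N) y ((\<Prod>i<N. j ((f ^^ i) y)) * j ((f ^^ N) y))"
      using Suc assms I by (intro jump_comp) (auto intro: prod_pos)
    then show ?case by (simp add: comp_def)
  qed
qed

section \<open>Piecewise affine bumps with three pieces\<close>

text \<open>The displacements of the two outer affine pieces agree, so that the middle piece is a
  translation.\<close>

locale three_pieces =
  fixes p q d1 d2 \<alpha> \<beta> :: real
  assumes d: "0 < d1" "0 < d2" and slopes: "0 < \<alpha>" "0 < \<beta>"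
    and fit: "p + d1 \<le> q - d2" and shift: "(\<alpha> - 1) * d1 = (1 - \<beta>) * d2"

definition pl3 :: "real \<Rightarrow> real \<Rightarrow> real \<Rightarrow> real \<Rightarrow> real \<Rightarrow> real \<Rightarrow> real \<Rightarrow> real" where
  "pl3 p q d1 d2 \<alpha> \<beta> y =
     (if y < p \<or> q \<le> y then y
      else if y < p + d1 then p + \<alpha> * (y - p)
      else if y < q - d2 then y + (\<alpha> - 1) * d1
      else q - \<beta> * (q - y))"

context three_pieces
begin

lemma pl3_out: "y \<le> p \<or> q \<le> y \<Longrightarrow> pl3 p q d1 d2 \<alpha> \<beta> y = y"
  using d fit by (auto simp: pl3_def)

lemma pl3_left: "p \<le> y \<Longrightarrow> y \<le> p + d1 \<Longrightarrow> pl3 p q d1 d2 \<alpha> \<beta> y = p + \<alpha> * (y - p)"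
  using d fit shift by (auto simp: pl3_def algebra_simps)

lemma pl3_mid: "p + d1 \<le> y \<Longrightarrow> y \<le> q - d2 \<Longrightarrow> pl3 p q d1 d2 \<alpha> \<beta> y = y + (\<alpha> - 1) * d1"
  using d fit shift by (auto simp: pl3_def algebra_simps)

lemma pl3_right: "q - d2 \<le> y \<Longrightarrow> y \<le> q \<Longrightarrow> pl3 p q d1 d2 \<alpha> \<beta> y = q - \<beta> * (q - y)"
  using d fit shift by (auto simp: pl3_def algebra_simps)

lemma pl3_cases:
  obtains "y < p \<or> q \<le> y" | "p \<le> y" "y < p + d1" | "p + d1 \<le> y" "y < q - d2" | "q - d2 \<le> y" "y < q"
  by force

lemma pl3_range_left: "p \<le> y \<Longrightarrow> y < p + d1 \<Longrightarrow>
    p \<le> pl3 p q d1 d2 \<alpha> \<beta> y \<and> pl3 p q d1 d2 \<alpha> \<beta> y < p + \<alpha> * d1"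
  using slopes by (simp add: pl3_left)

lemma pl3_range_right: "q - d2 \<le> y \<Longrightarrow> y < q \<Longrightarrow>
    q - \<beta> * d2 \<le> pl3 p q d1 d2 \<alpha> \<beta> y \<and> pl3 p q d1 d2 \<alpha> \<beta> y < q"
  using slopes by (simp add: pl3_right)

lemma pl3_range_mid: "p + d1 \<le> y \<Longrightarrow> y < q - d2 \<Longrightarrow>
    p + \<alpha> * d1 \<le> pl3 p q d1 d2 \<alpha> \<beta> y \<and> pl3 p q d1 d2 \<alpha> \<beta> y < q - \<beta> * d2"
  using shift by (simp add: pl3_mid algebra_simps)

lemma fit': "p + \<alpha> * d1 \<le> q - \<beta> * d2"
  using shift fit by (simp add: algebra_simps)

text \<open>The outer pieces are mapped onto pieces of lengths \<open>\<alpha> * d1\<close> and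
  \<open>\<beta> * d2\<close>, so the inverse has the same shape with reciprocal slopes.
  Surjectivity and the membership of inverses in the group follow from this.\<close>

lemma three_pieces_inverse: "three_pieces p q (\<alpha> * d1) (\<beta> * d2) (1 / \<alpha>) (1 / \<beta>)"
  using d slopes fit' shift by unfold_locales (simp_all add: algebra_simps)

lemma pl3_inverse:
  "pl3 p q (\<alpha> * d1) (\<beta> * d2) (1 / \<alpha>) (1 / \<beta>) (pl3 p q d1 d2 \<alpha> \<beta> y) = y"
proof -
  interpret inv: three_pieces p q "\<alpha> * d1" "\<beta> * d2" "1 / \<alpha>" "1 / \<beta>"
    by (rule three_pieces_inverse)
  show ?thesis
  proof (cases y rule: pl3_cases)
    case 1
    then show ?thesis by (auto simp: pl3_out inv.pl3_out)
  next
    case 2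
    then show ?thesis using pl3_range_left[of y] slopes
      by (subst inv.pl3_left) (auto simp: pl3_left)
  next
    case 3
    then show ?thesis using pl3_range_mid[of y] slopes
      by (subst inv.pl3_mid) (auto simp: pl3_mid algebra_simps)
  next
    case 4
    then show ?thesis using pl3_range_right[of y] slopes
      by (subst inv.pl3_right) (auto simp: pl3_right)
  qed
qed

lemma pl3_inverse': "pl3 p q d1 d2 \<alpha> \<beta> (pl3 p q (\<alpha> * d1) (\<beta> * d2) (1 / \<alpha>) (1 / \<beta>) y) = y"
proof -
  interpret inv: three_pieces p q "\<alpha> * d1" "\<beta> * d2" "1 / \<alpha>" "1 / \<beta>"
    by (rule three_pieces_inverse)
  show ?thesis using inv.pl3_inverse[of y] slopes by simp
qed

lemma surj_pl3: "surj (pl3 p q d1 d2 \<alpha> \<beta>)"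
  using pl3_inverse' by (metis surjI)

lemma inv_pl3:
  "inv_into UNIV (pl3 p q d1 d2 \<alpha> \<beta>) = pl3 p q (\<alpha> * d1) (\<beta> * d2) (1 / \<alpha>) (1 / \<beta>)"
  using pl3_inverse pl3_inverse' by (intro inv_equality)

lemma strict_mono_pl3: "strict_mono (pl3 p q d1 d2 \<alpha> \<beta>)"
proof (rule strict_monoI)
  fix y z :: real assume yz: "y < z"
  let ?f = "pl3 p q d1 d2 \<alpha> \<beta>"
  have a: "p < p + \<alpha> * d1" "q - \<beta> * d2 < q" using d slopes by simp_all
  have out: "z < p \<or> q \<le> z \<Longrightarrow> ?f z = z" "y < p \<or> q \<le> y \<Longrightarrow> ?f y = y"
    by (simp_all add: pl3_def)
  show "?f y < ?f z"
  proof (cases y rule: pl3_cases)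
    case 1
    show ?thesis
      by (cases z rule: pl3_cases)
        (use 1 yz a fit' out pl3_range_left[of z] pl3_range_mid[of z] pl3_range_right[of z] d fit in auto)
  next
    case 2
    have inner: "?f y < ?f z" if "z < p + d1" using that 2 yz slopes by (simp add: pl3_left)
    show ?thesis
      by (cases z rule: pl3_cases)
        (use 2 yz a fit' out pl3_range_left[of y] pl3_range_mid[of z] pl3_range_right[of z] d fit inner
          in auto)
  next
    case 3
    show ?thesis
      by (cases z rule: pl3_cases)
        (use 3 yz a fit' out pl3_range_mid[of y] pl3_range_right[of z] d fit
          in \<open>auto simp: pl3_mid\<close>)
  next
    case 4
    have inner: "?f y < ?f z" if "z < q" using that 4 yz slopes by (simp add: pl3_right)
    show ?thesis
      by (cases z rule: pl3_cases)
        (use 4 yz a fit' out pl3_range_right[of y] d fit inner in auto)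
  qed
qed

text \<open>By \<open>shift\<close>, \<alpha> > 1 forces \<beta> < 1, so each of the three pieces
  moves points to the right.\<close>

lemma bump_on_pl3:
  assumes "1 < \<alpha>"
  shows "bump_on (pl3 p q d1 d2 \<alpha> \<beta>) p q"
proof -
  have \<beta>: "\<beta> < 1"
  proof (rule ccontr)
    assume "\<not> \<beta> < 1"
    then have "(1 - \<beta>) * d2 \<le> 0" using d by (simp add: mult_nonpos_nonneg)
    moreover have "0 < (\<alpha> - 1) * d1" using d assms by simp
    ultimately show False using shift by simp
  qed
  have "y < pl3 p q d1 d2 \<alpha> \<beta> y" if y: "p < y" "y < q" for y
  proof (cases y rule: pl3_cases)
    case 2
    have "1 * (y - p) < \<alpha> * (y - p)" using y assms by (intro mult_strict_right_mono) auto
    then show ?thesis using 2 by (simp add: pl3_left)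
  next
    case 4
    have "\<beta> * (q - y) < 1 * (q - y)" using y \<beta> by (intro mult_strict_right_mono) auto
    then have "\<beta> * (q - y) < q - y" by simp
    then have "y < q - \<beta> * (q - y)" by linarith
    then show ?thesis using 4 by (simp add: pl3_right)
  qed (use y assms d in \<open>auto simp: pl3_mid\<close>)
  then show ?thesis
    unfolding bump_on_def using strict_mono_pl3 surj_pl3 pl3_out by force
qed

text \<open>The slopes are \<alpha>, 1, \<beta> in this order, so the two quotients are 1/\<alpha>
  and \<beta>. The strict inequality \<open>fit\<close> keeps the two breakpoints apart; if they
  coincided, the quotients would multiply.\<close>

lemma jump_pl3:
  assumes y: "p < y" "y < q" and fit: "p + d1 < q - d2"
  shows "jump (pl3 p q d1 d2 \<alpha> \<beta>) y (if y = p + d1 then 1 / \<alpha> else if y = q - d2 then \<beta> else 1)"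
proof -
  consider "y < p + d1" | "y = p + d1" | "p + d1 < y" "y < q - d2" | "y = q - d2" | "q - d2 < y"
    by linarith
  then show ?thesis
  proof cases
    case 1
    have "jump (pl3 p q d1 d2 \<alpha> \<beta>) y 1"
      by (rule jump_affine[of p "p + d1" _ \<alpha> "p - \<alpha> * p"])
        (use 1 y slopes in \<open>auto simp: pl3_left algebra_simps\<close>)
    then show ?thesis using 1 fit by simp
  next
    case 2
    have "jump (pl3 p q d1 d2 \<alpha> \<beta>) y (1 / \<alpha>)"
      by (rule jumpI[of "min d1 (q - d2 - (p + d1))" \<alpha>])
        (use 2 d fit slopes in \<open>auto simp: pl3_left pl3_mid algebra_simps\<close>)
    then show ?thesis using 2 by simp
  next
    case 3
    have "jump (pl3 p q d1 d2 \<alpha> \<beta>) y 1"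
      by (rule jump_affine[of "p + d1" "q - d2" _ 1 "(\<alpha> - 1) * d1"])
        (use 3 y slopes in \<open>auto simp: pl3_mid algebra_simps\<close>)
    then show ?thesis using 3 by simp
  next
    case 4
    have "jump (pl3 p q d1 d2 \<alpha> \<beta>) y \<beta>"
      by (rule jumpI[of "min d2 (q - d2 - (p + d1))" 1])
        (use 4 d fit slopes shift in \<open>auto simp: pl3_right pl3_mid algebra_simps\<close>)
    then show ?thesis using 4 fit by simp
  next
    case 5
    have "jump (pl3 p q d1 d2 \<alpha> \<beta>) y 1"
      by (rule jump_affine[of "q - d2" q _ \<beta> "q - \<beta> * q"])
        (use 5 y slopes in \<open>auto simp: pl3_right algebra_simps\<close>)
    then show ?thesis using 5 fit by simp
  qed
qed

end

section \<open>The centralizer of a three-piece bump\<close>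

text \<open>The only properties of the ambient group that matter: it consists of bijections of
  \<open>[0,r)\<close> that are affine near both ends of the interval.\<close>

locale end_affine_group =
  fixes G :: "(real \<Rightarrow> real) set" and r :: real
  assumes r_pos: "0 < r"
    and id_in: "id \<in> G"
    and comp_in: "x \<in> G \<Longrightarrow> y \<in> G \<Longrightarrow> x \<circ> y \<in> G"
    and bij_in: "x \<in> G \<Longrightarrow> bij x"
    and out: "x \<in> G \<Longrightarrow> v \<notin> {0..<r} \<Longrightarrow> x v = v"
    and affine_0: "x \<in> G \<Longrightarrow> \<exists>\<epsilon>>0. \<exists>s>0. \<exists>c. \<forall>v. 0 \<le> v \<and> v < \<epsilon> \<longrightarrow> x v = s * v + c"
    and affine_r: "x \<in> G \<Longrightarrow> \<exists>\<epsilon><r. \<exists>s>0. \<exists>c. \<forall>v. \<epsilon> < v \<and> v < r \<longrightarrow> x v = s * v + c"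
begin

section \<open>Orbits of a bump on the whole interval, and maps commuting with it\<close>

context
  fixes t :: "real \<Rightarrow> real"
  assumes t_in: "t \<in> G" "inv_into UNIV t \<in> G" and bump_t: "bump_on t 0 r"
begin

lemma zpow_in: "zpow t i \<in> G"
  using zpow_closed[OF bij_in[OF t_in(1)] t_in id_in comp_in] by blast

lemma zpow_cancel: "zpow t i (zpow t j y) = zpow t (i + j) y"
  using zpow_add[OF bij_in[OF t_in(1)], of i j] by simp

lemma bij_t: "bij t"
  by (rule bij_in[OF t_in(1)])

lemma zpow_range: "0 < zpow t i y \<and> zpow t i y < r \<longleftrightarrow> 0 < y \<and> y < r"
proof (rule commute_bump_on_range[OF bump_t])
  show "inj (zpow t i)" using bij_in[OF zpow_in] by (simp add: bij_def)
  show "zpow t i \<circ> t = t \<circ> zpow t i" using commute_zpow[OF bij_t, of t i] by metis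
qed

lemma strict_mono_zpow: "strict_mono (zpow t i)"
proof (cases "0 \<le> i")
  case True
  then obtain n where "i = int n" by (metis nonneg_int_cases)
  then show ?thesis using bump_on_funpow(1)[OF bump_t] by (simp add: strict_mono_def)
next
  case False
  then obtain n where n: "i = - int n" by (metis linear nonpos_int_cases)
  show ?thesis
  proof (rule strict_monoI)
    fix y z :: real assume "y < z"
    then have "zpow t (int n) (zpow t i y) < zpow t (int n) (zpow t i z)"
      by (simp add: zpow_cancel n del: zpow_of_nat)
    then show "zpow t i y < zpow t i z" using bump_on_funpow(1)[OF bump_t] by simp
  qed
qed

lemma zpow_less_succ:
  assumes "0 < y" "y < r"
  shows "zpow t i y < zpow t (i + 1) y"
  using bump_onD(5)[OF bump_t, of "zpow t i y"] zpow_range[of i y] assms zpow_succ[OF bij_t, of i] by simp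

lemma strict_mono_orbit:
  assumes "0 < y" "y < r"
  shows "strict_mono (\<lambda>i. zpow t i y)"
proof (rule strict_monoI)
  fix i j :: int assume "i < j"
  then show "zpow t i y < zpow t j y"
    by (induction j rule: int_gr_induct)
      (use zpow_less_succ[OF assms] in \<open>auto intro: less_trans\<close>)
qed

text \<open>The forward orbit of a small point \<open>z\<close> eventually passes \<open>y\<close>;
  pulling back by the same power of \<open>t\<close> puts \<open>y\<close> below
  \<open>z\<close>.\<close>

lemma orbit_near_0:
  assumes "0 < y" "y < r" "0 < \<epsilon>"
  shows "\<exists>k. zpow t (- int k) y < \<epsilon>"
proof -
  define z where "z = min \<epsilon> y / 2"
  have z: "0 < z" "z < r" "z < \<epsilon>" using assms by (auto simp: z_def)
  obtain k where "y < (t ^^ k) z" using bump_on_orbit_exceeds[OF bump_t z(1,2) assms(2)] by blast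
  then have "zpow t (- int k) y < zpow t (- int k) (zpow t (int k) z)"
    using strict_mono_zpow by (simp add: strict_mono_def)
  also have "\<dots> = z" by (simp add: zpow_cancel del: zpow_of_nat)
  finally show ?thesis using z(3) by (meson less_trans)
qed

text \<open>\<open>h\<close> fixes the whole \<open>t\<close>-orbit of \<open>e\<close>, which
  accumulates at 0, where \<open>h\<close> is affine. An affine map with two fixed points is the
  identity, so \<open>h\<close> is the identity near 0; powers of \<open>t\<close> carry this to
  every point of the open interval.\<close>

lemma eq_id_if_commute_fix:
  assumes h: "h \<in> G" "h \<circ> t = t \<circ> h" and e: "0 < e" "e < r" "h e = e"
  shows "h = id"
proof -
  have comm: "h (zpow t i y) = zpow t i (h y)" for i y
    using commute_zpow[OF bij_t h(2), of i] by (metis comp_apply)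
  obtain \<epsilon> s c where aff: "0 < \<epsilon>" "0 < s" "\<And>y. 0 \<le> y \<Longrightarrow> y < \<epsilon> \<Longrightarrow> h y = s * y + c"
    using affine_0[OF h(1)] by blast
  obtain k where k: "zpow t (- int k) e < \<epsilon>" using orbit_near_0 e aff(1) by blast
  define p p' where "p = zpow t (- int k) e" and "p' = zpow t (- int k - 1) e"
  have p: "0 < p'" "p' < p" "p < \<epsilon>"
    using zpow_range[of "- int k - 1" e] zpow_less_succ[of e "- int k - 1"] e k
    by (simp_all add: p_def p'_def)
  have "h p = p" "h p' = p'" by (simp_all add: p_def p'_def comm e(3))
  then have fx: "s * p + c = p" "s * p' + c = p'" using aff(3)[of p] aff(3)[of p'] p by auto
  then have "(s - 1) * (p - p') = 0" by (simp add: algebra_simps)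
  then have "s = 1" using p by simp
  then have near: "h y = y" if "0 \<le> y" "y < \<epsilon>" for y using aff(3)[of y] that fx by simp
  have "h y = y" for y
  proof (cases "0 < y \<and> y < r")
    case True
    then obtain k where k: "zpow t (- int k) y < \<epsilon>" using orbit_near_0 aff(1) by blast
    define z where "z = zpow t (- int k) y"
    have "0 < z" "z < \<epsilon>" using True zpow_range[of "- int k" y] k by (auto simp: z_def)
    then have "h z = z" using near by simp
    moreover have "y = zpow t (int k) z" by (simp add: z_def zpow_cancel del: zpow_of_nat)
    ultimately show ?thesis using comm by metis
  next
    case False
    then show ?thesis using near[of y] out[OF h(1), of y] aff(1) by (cases "y = 0") auto
  qed
  then show ?thesis by auto
qed

end

text \<open>If \<open>h\<close> commutes with \<open>t\<close>, then it commutes with \<open>\<phi> = t ^^ N\<close>. For \<open>y\<close> close to 0 and \<open>\<phi> y\<close>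
  close to \<open>r\<close>, where \<open>h\<close> has no breakpoints, the jumps of \<open>\<phi>\<close> at \<open>y\<close> and at \<open>h y\<close> agree. These jumps
  tell the \<open>t\<close>-orbit of the first breakpoint of \<open>t\<close> from all others, so \<open>h\<close> preserves this orbit.\<close>

lemma centralizer_pl3_subset_powers:
  fixes d1 d2 \<alpha> \<beta> :: real
  defines "t \<equiv> pl3 0 r d1 d2 \<alpha> \<beta>"
  assumes tp: "three_pieces 0 r d1 d2 \<alpha> \<beta>" and \<alpha>: "1 < \<alpha>" "1 / \<alpha> < \<beta>" "\<beta> < 1" and gap: "d1 < r - d2"
    and t: "t \<in> G" "inv_into UNIV t \<in> G" and h: "h \<in> G" "h \<circ> t = t \<circ> h"
  shows "\<exists>i. h = zpow t i"
proof -
  interpret three_pieces 0 r d1 d2 \<alpha> \<beta> by (rule tp)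
  have bump: "bump_on t 0 r" unfolding t_def using \<alpha> by (intro bump_on_pl3)
  note bij_t = bij_t[OF t bump]
  note zc = zpow_cancel[OF t bump]
  have comm: "h (zpow t i y) = zpow t i (h y)" for i y
    using commute_zpow[OF bij_t h(2), of i] by (metis comp_apply)
  have d1: "0 < d1" "d1 < r" using d gap by auto
  define j where "j y = (if y = d1 then 1 / \<alpha> else if y = r - d2 then \<beta> else 1)" for y
  have j: "0 < j y" "j y \<le> 1" for y using slopes \<alpha> by (auto simp: j_def)
  have jump_t: "jump (t ^^ N) y (\<Prod>i<N. j ((t ^^ i) y))" if "0 < y" "y < r" for N y
  proof (rule jump_funpow[where I = "{0<..<r}"])
    fix y assume "y \<in> {0<..<r}"
    then show "t y \<in> {0<..<r} \<and> jump t y (j y)"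
      using bump_on_range[OF bump, of y] jump_pl3[of y] gap by (simp add: t_def j_def)
  qed (use j that in auto)
  obtain \<epsilon> s c where aff: "0 < \<epsilon>" "0 < s" "\<And>y. 0 \<le> y \<Longrightarrow> y < \<epsilon> \<Longrightarrow> h y = s * y + c"
    using affine_0[OF h(1)] by blast
  obtain \<epsilon>' s' c' where aff': "\<epsilon>' < r" "0 < s'" "\<And>y. \<epsilon>' < y \<Longrightarrow> y < r \<Longrightarrow> h y = s' * y + c'"
    using affine_r[OF h(1)] by blast
  obtain k where k: "zpow t (- int k) d1 < \<epsilon>" using orbit_near_0[OF t bump d1 aff(1)] by blast
  \<comment> \<open>A backward iterate of the first breakpoint \<open>d1\<close>, so close to 0 that
    \<open>h\<close> is affine around it; \<open>k\<close> steps of \<open>t\<close> lead back to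
    \<open>d1\<close>.\<close>
  define y where "y = zpow t (- int k) d1"
  have y: "0 < y" "y < r" "y < \<epsilon>"
    using zpow_range[OF t bump, of "- int k" d1] d1 k by (auto simp: y_def)
  have y_k: "(t ^^ k) y = d1" using zc[of "int k" "- int k" d1] by (simp add: y_def)
  obtain N0 where N0: "\<epsilon>' < (t ^^ N0) y" using bump_on_orbit_exceeds[OF bump y(1,2) aff'(1)] by blast
  \<comment> \<open>\<open>Suc k\<close> ensures that the factor at \<open>(t ^^ k) y = d1\<close>
    occurs in the product of jumps below; \<open>N0\<close> brings \<open>(t ^^ N) y\<close> onto
    the last affine piece of \<open>h\<close>.\<close>
  define N where "N = max N0 (Suc k)"
  have "(t ^^ N0) y \<le> (t ^^ N) y"
    using strict_mono_less_eq[OF bump_on_funpow_strict_mono[OF bump y(1,2)]] by (simp add: N_def)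
  then have N: "\<epsilon>' < (t ^^ N) y" "(t ^^ N) y < r" "k < N"
    using N0 bump_on_funpow(2)[OF bump, of N y] y by (auto simp: N_def)
  have hy: "0 < h y" "h y < r"
    using commute_bump_on_range[OF bump _ h(2), of y] bij_in[OF h(1)] y by (auto simp: bij_def)
  let ?J = "\<lambda>y. \<Prod>i<N. j ((t ^^ i) y)"
  have "jump h y 1" using aff y by (intro jump_affine[of 0 \<epsilon> h s c]) auto
  moreover have "jump h ((t ^^ N) y) 1" using aff' N by (intro jump_affine[of \<epsilon>' r h s' c']) auto
  moreover have "0 < ?J y" using j by (intro prod_pos) auto
  ultimately have "jump (h \<circ> t ^^ N) y (?J y * 1)" "jump (t ^^ N \<circ> h) y (1 * ?J (h y))"
    using jump_t[OF y(1,2)] jump_t[OF hy] jump_comp[of "t ^^ N" y "?J y" h 1]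
      jump_comp[of h y 1 "t ^^ N" "?J (h y)"] by simp_all
  moreover have "h \<circ> t ^^ N = t ^^ N \<circ> h" using commute_zpow[OF bij_t h(2), of "int N"] by simp
  ultimately have J: "?J y = ?J (h y)" using jump_unique by fastforce
  \<comment> \<open>Otherwise no factor of \<open>?J (h y)\<close> is 1/\<alpha>, and at most one is
    \<beta> because the orbit is strictly increasing; so \<open>?J (h y)\<close> is at least
    \<beta>. But \<open>?J y\<close> contains the factor 1/\<alpha> < \<beta>, and no factor exceeds
    1.\<close>
  have "\<exists>i<N. (t ^^ i) (h y) = d1"
  proof (rule ccontr)
    assume no: "\<not> ?thesis"
    have "?J y = j ((t ^^ k) y) * (\<Prod>i\<in>{..<N} - {k}. j ((t ^^ i) y))"
      using N(3) by (simp add: prod.remove)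
    also have "\<dots> \<le> j ((t ^^ k) y) * 1"
      using j by (intro mult_left_mono prod_le_1) (auto intro: less_imp_le)
    finally have "?J y \<le> 1 / \<alpha>" by (simp add: y_k j_def)
    moreover have "\<beta> \<le> ?J (h y)"
    proof (cases "\<exists>m<N. (t ^^ m) (h y) = r - d2")
      case True
      then obtain m where m: "m < N" "(t ^^ m) (h y) = r - d2" by blast
      have "(t ^^ i) (h y) = r - d2 \<longleftrightarrow> i = m" for i
        using strict_mono_eq[OF bump_on_funpow_strict_mono[OF bump hy], of i m] m by auto
      then have "?J (h y) = (\<Prod>i<N. if i = m then \<beta> else 1)"
        using no by (intro prod.cong) (auto simp: j_def)
      then show ?thesis using m by simp
    next
      case False
      then have "?J (h y) = (\<Prod>i<N. 1)" using no by (intro prod.cong) (auto simp: j_def)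
      then show ?thesis using \<alpha> by simp
    qed
    ultimately show False using J \<alpha> by simp
  qed
  then obtain i where i: "(t ^^ i) (h y) = d1" by blast
  \<comment> \<open>Corrected by a power of \<open>t\<close>, the map fixes \<open>d1\<close> and
    still commutes with \<open>t\<close>, which makes it the identity.\<close>
  define h' where "h' = zpow t (int i - int k) \<circ> h"
  have "h' d1 = zpow t (int i - int k) (zpow t (int k) (h y))"
    unfolding h'_def comp_apply using comm[of "int k" y] y_k by simp
  also have "\<dots> = d1" using zc[of "int i - int k" "int k" "h y"] i by simp
  finally have fx: "h' d1 = d1" .
  have "h' \<circ> t = t \<circ> h'"
    unfolding h'_def using h(2) commute_zpow[OF bij_t refl, of "int i - int k"] by (metis comp_assoc)
  moreover have "h' \<in> G" unfolding h'_def by (rule comp_in[OF zpow_in[OF t bump] h(1)])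
  ultimately have "h' = id" using eq_id_if_commute_fix[of t h' d1] t bump d1 fx by blast
  then have "h z = zpow t (int k - int i) z" for z
    using zc[of "int k - int i" "int i - int k" "h z"] by (simp add: h'_def fun_eq_iff)
  then show ?thesis by blast
qed

end

section \<open>Divisibility of exponents\<close>

locale wreath_setup = end_affine_group G r for G r +
  fixes t a u :: "real \<Rightarrow> real" and e :: real
  assumes t_in: "t \<in> G" "inv_into UNIV t \<in> G" and a_in: "a \<in> G" and u_in: "u \<in> G"
    and e: "0 < e" "e < r"
    and bump_t: "bump_on t 0 r" and bump_a: "bump_on a e (t e)" and bump_u: "bump_on u 0 e"
    and centralizer_t: "h \<in> G \<Longrightarrow> h \<circ> t = t \<circ> h \<Longrightarrow> \<exists>i. h = zpow t i"
begin

section \<open>Fundamental domains of \<open>t\<close> and the conjugates of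
  \<open>a\<close>\<close>

definition P :: "int \<Rightarrow> real" where "P i = zpow t i e"

definition conj_a :: "int \<Rightarrow> real \<Rightarrow> real" where
  "conj_a i = zpow t i \<circ> a \<circ> zpow t (- i)"

lemmas zpow_in' = zpow_in[OF t_in bump_t]
  and zpow_cancel' = zpow_cancel[OF t_in bump_t]
  and bij_t' = bij_t[OF t_in bump_t]

lemma zpow_comp: "zpow t i \<circ> zpow t j = zpow t (i + j)"
  by (rule zpow_add[OF bij_t', symmetric])

lemma zpow_comp': "zpow t i \<circ> (zpow t j \<circ> f) = zpow t (i + j) \<circ> f"
  by (simp add: zpow_comp flip: comp_assoc)

lemma conj_a_0: "conj_a 0 = a"
  by (simp add: conj_a_def)

lemma conj_a_in: "conj_a i \<in> G"
  unfolding conj_a_def by (intro comp_in zpow_in' a_in)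

lemma conj_a_zpow: "conj_a i \<circ> zpow t i = zpow t i \<circ> a"
  by (simp add: conj_a_def zpow_comp comp_assoc)

lemma conj_a_unique: "x \<circ> zpow t i = zpow t i \<circ> a \<Longrightarrow> x = conj_a i"
  unfolding conj_a_def by (metis add.right_inverse comp_assoc comp_id zpow_comp zpow_0)

lemma conj_conj_a: "zpow t i \<circ> conj_a j \<circ> zpow t (- i) = conj_a (i + j)"
  by (simp add: conj_a_def zpow_comp zpow_comp' comp_assoc add_ac)

lemma strict_mono_P: "strict_mono P"
  using strict_mono_orbit[OF t_in bump_t e] by (simp add: P_def[abs_def])

lemma P_less: "P i < P j \<longleftrightarrow> i < j"
  by (rule strict_mono_less[OF strict_mono_P])

lemma P_0: "P 0 = e"
  by (simp add: P_def)

lemma P_range: "0 < P i" "P i < r"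
  using zpow_range[OF t_in bump_t, of i e] e by (simp_all add: P_def)

lemma bump_conj_a: "bump_on (conj_a i) (P i) (P (i + 1))"
proof -
  have "zpow t i (t e) = P (i + 1)" using zpow_cancel'[of i 1 e] by (simp add: P_def)
  moreover have "bump_on (conj_a i) (zpow t i e) (zpow t i (t e))"
    unfolding conj_a_def using strict_mono_zpow[OF t_in bump_t] bump_a
    by (intro bump_on_conj) (simp_all add: zpow_comp)
  ultimately show ?thesis by (simp add: P_def)
qed

lemma conj_a_commute: "conj_a i \<circ> conj_a j = conj_a j \<circ> conj_a i"
proof -
  have "conj_a i \<circ> conj_a j = conj_a j \<circ> conj_a i" if "i < j" for i j
  proof (rule bump_on_commute[OF bump_conj_a bump_conj_a])
    show "P (i + 1) \<le> P j" using that strict_mono_less_eq[OF strict_mono_P] by simp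
  qed
  then show ?thesis by (metis linorder_cases)
qed

text \<open>For i \<ge> 0 the supports are disjoint. For i < 0 the point \<open>P i\<close> lies
  inside the support of \<open>u\<close>, so \<open>u\<close> moves it and cannot preserve the
  support of \<open>conj_a i\<close>.\<close>

lemma conj_a_commute_u: "conj_a i \<circ> u = u \<circ> conj_a i \<longleftrightarrow> 0 \<le> i"
proof
  assume "0 \<le> i"
  then have "e \<le> P i" using strict_mono_less_eq[OF strict_mono_P, of 0 i] by (simp add: P_0)
  then show "conj_a i \<circ> u = u \<circ> conj_a i" using bump_on_commute[OF bump_u bump_conj_a] by simp
next
  assume comm: "conj_a i \<circ> u = u \<circ> conj_a i"
  show "0 \<le> i"
  proof (rule ccontr)
    assume "\<not> 0 \<le> i"
    then have "P i < e" using P_less[of i 0] by (simp add: P_0)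
    then have up: "P i < u (P i)" using bump_onD(5)[OF bump_u] P_range by simp
    \<comment> \<open>A point of the support of \<open>conj_a i\<close> below
      \<open>u (P i)\<close>. By monotonicity its preimage under \<open>u\<close> lies to the left
      of \<open>P i\<close>, whereas commutation puts it into the support.\<close>
    define y where "y = (P i + min (u (P i)) (P (i + 1))) / 2"
    have y: "P i < y" "y < u (P i)" "y < P (i + 1)" using up P_less[of i "i + 1"] by (auto simp: y_def)
    obtain z where z: "u z = y" using bump_onD(2)[OF bump_u] by (metis surjD)
    have "P i < z"
      using commute_bump_on_range[OF bump_conj_a, of u i z] comm z y bij_in[OF u_in]
      by (auto simp: bij_def)
    then have "u (P i) < y" using bump_onD(4)[OF bump_u] z by blast
    then show False using y by simp
  qed
qed

abbreviation mul :: "(real \<Rightarrow> real) \<Rightarrow> (real \<Rightarrow> real) \<Rightarrow> real \<Rightarrow> real" where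
  "mul \<equiv> (\<lambda>x y. y \<circ> x)"

lemma is_nat_iff:
  assumes "h \<in> G"
  shows "is_nat G mul t a u h \<longleftrightarrow> h \<in> range (\<lambda>n. t ^^ n)"
proof
  assume h: "is_nat G mul t a u h"
  then obtain x where x: "h \<circ> t = t \<circ> h" "x \<circ> h = h \<circ> a" "u \<circ> x = x \<circ> u"
    unfolding is_nat_def by metis
  obtain i where i: "h = zpow t i" using centralizer_t[OF assms x(1)] by blast
  have "x = conj_a i" using conj_a_unique x(2) i by blast
  then have "0 \<le> i" using conj_a_commute_u x(3) by metis
  then show "h \<in> range (\<lambda>n. t ^^ n)" unfolding i by (simp add: zpow_def)
next
  assume "h \<in> range (\<lambda>n. t ^^ n)"
  then obtain n where n: "h = zpow t (int n)" by auto
  have "h \<circ> t = t \<circ> h" unfolding n using commute_zpow[OF bij_t' refl] by metis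
  moreover have "conj_a (int n) \<circ> h = h \<circ> a" unfolding n by (rule conj_a_zpow)
  moreover have "u \<circ> conj_a (int n) = conj_a (int n) \<circ> u" using conj_a_commute_u[of "int n"] by simp
  ultimately show "is_nat G mul t a u h" unfolding is_nat_def using conj_a_in by metis
qed

lemma in_base_iff: "in_base G mul t a b \<longleftrightarrow> (\<forall>i. conj_a i \<circ> b = b \<circ> conj_a i)"
proof
  assume b: "in_base G mul t a b"
  show "\<forall>i. conj_a i \<circ> b = b \<circ> conj_a i"
  proof
    fix i
    have "zpow t i \<circ> t = t \<circ> zpow t i" using commute_zpow[OF bij_t' refl] by metis
    then show "conj_a i \<circ> b = b \<circ> conj_a i"
      using b zpow_in' conj_a_in conj_a_zpow unfolding in_base_def by metis
  qed
next
  assume b: "\<forall>i. conj_a i \<circ> b = b \<circ> conj_a i"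
  show "in_base G mul t a b"
    unfolding in_base_def
  proof (intro ballI impI)
    fix h x assume h: "h \<in> G" "t \<circ> h = h \<circ> t" "x \<circ> h = h \<circ> a"
    then obtain i where "h = zpow t i" using centralizer_t by metis
    then show "b \<circ> x = x \<circ> b" using conj_a_unique h(3) b by metis
  qed
qed

section \<open>Elements of the base are trivial on all but finitely many fundamental domains\<close>

lemma P_near_0: "0 < \<epsilon> \<Longrightarrow> \<exists>k::nat. \<forall>i\<le>- int k. P i < \<epsilon>"
  using orbit_near_0[OF t_in bump_t e, of \<epsilon>] strict_mono_less_eq[OF strict_mono_P]
  by (metis P_def le_less_trans)

lemma P_near_r: "\<epsilon> < r \<Longrightarrow> \<exists>k::nat. \<forall>i\<ge>int k. \<epsilon> < P i"
  using bump_on_orbit_exceeds[OF bump_t e, of \<epsilon>] strict_mono_less_eq[OF strict_mono_P]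
  by (metis P_def less_le_trans zpow_of_nat)

definition id_on :: "(real \<Rightarrow> real) \<Rightarrow> int \<Rightarrow> bool" where
  "id_on b i \<longleftrightarrow> (\<forall>y. P i < y \<and> y < P (i + 1) \<longrightarrow> b y = y)"

lemma base_range:
  assumes "b \<in> G" "\<And>i. conj_a i \<circ> b = b \<circ> conj_a i"
  shows "P i < b y \<and> b y < P (i + 1) \<longleftrightarrow> P i < y \<and> y < P (i + 1)"
  using commute_bump_on_range[OF bump_conj_a] assms bij_in[OF assms(1)] by (metis bij_def)

text \<open>\<open>b\<close> maps the open domain onto itself. The image of an interval under an
  increasing affine map is bounded by the images of its end points, so both end points are fixed by
  the affine map and the slope is 1.\<close>

lemma affine_base_id_on:
  assumes b: "b \<in> G" "\<And>i. conj_a i \<circ> b = b \<circ> conj_a i"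
    and aff: "0 < s" "\<And>y. P i < y \<Longrightarrow> y < P (i + 1) \<Longrightarrow> b y = s * y + c"
  shows "id_on b i"
proof -
  let ?p = "P i" and ?q = "P (i + 1)"
  have pq: "?p < ?q" by (simp add: P_less)
  have "{s * ?p + c<..<s * ?q + c} = {?p<..<?q}"
  proof (intro equalityI subsetI)
    fix z assume "z \<in> {s * ?p + c<..<s * ?q + c}"
    then have "?p < (z - c) / s" "(z - c) / s < ?q" using aff(1) by (simp_all add: field_simps)
    then show "z \<in> {?p<..<?q}"
      using aff base_range[OF b, where y = "(z - c) / s" and i = i] by simp
  next
    fix z assume z: "z \<in> {?p<..<?q}"
    obtain y where y: "b y = z" using bij_in[OF b(1)] by (metis bij_pointE)
    then have "?p < y" "y < ?q" using z base_range[OF b, where y = y and i = i] by auto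
    then show "z \<in> {s * ?p + c<..<s * ?q + c}" using aff y by auto
  qed
  moreover have "s * ?p + c < s * ?q + c" using pq aff(1) by simp
  ultimately have eq: "s * ?p + c = ?p" "s * ?q + c = ?q"
    using pq by (metis cInf_greaterThanLessThan, metis cSup_greaterThanLessThan)
  then have "(s - 1) * (?q - ?p) = 0" by (simp add: algebra_simps)
  then have "s = 1" using pq by simp
  then show ?thesis using aff eq by (simp add: id_on_def)
qed

lemma base_id_near_0:
  assumes b: "b \<in> G" "\<And>i. conj_a i \<circ> b = b \<circ> conj_a i"
  shows "\<exists>k::nat. \<forall>i\<le>- int k. id_on b i"
proof -
  obtain \<epsilon> s c where aff: "0 < \<epsilon>" "0 < s" "\<And>y. 0 \<le> y \<Longrightarrow> y < \<epsilon> \<Longrightarrow> b y = s * y + c"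
    using affine_0[OF b(1)] by blast
  obtain k :: nat where k: "\<And>i. i \<le> - int k \<Longrightarrow> P i < \<epsilon>" using P_near_0 aff(1) by blast
  \<comment> \<open>\<open>Suc k\<close> because the domain reaches up to \<open>P (i + 1)\<close>,
    which has to be below \<epsilon> as well.\<close>
  have "id_on b i" if "i \<le> - int (Suc k)" for i
  proof (rule affine_base_id_on[OF b aff(2)])
    fix y assume "P i < y" "y < P (i + 1)"
    then show "b y = s * y + c" using P_range(1)[of i] k[of "i + 1"] that by (intro aff(3)) auto
  qed
  then show ?thesis by blast
qed

lemma base_id_near_r:
  assumes b: "b \<in> G" "\<And>i. conj_a i \<circ> b = b \<circ> conj_a i"
  shows "\<exists>k::nat. \<forall>i\<ge>int k. id_on b i"
proof -
  obtain \<epsilon> s c where aff: "\<epsilon> < r" "0 < s" "\<And>y. \<epsilon> < y \<Longrightarrow> y < r \<Longrightarrow> b y = s * y + c"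
    using affine_r[OF b(1)] by blast
  obtain k :: nat where k: "\<And>i. i \<ge> int k \<Longrightarrow> \<epsilon> < P i" using P_near_r aff(1) by blast
  have "id_on b i" if "i \<ge> int k" for i
  proof (rule affine_base_id_on[OF b aff(2)])
    fix y assume "P i < y" "y < P (i + 1)"
    then show "b y = s * y + c" using P_range(2)[of "i + 1"] k[of i] that by (intro aff(3)) auto
  qed
  then show ?thesis by blast
qed

lemma not_id_on_conj_a: "\<not> id_on (conj_a i) i"
proof -
  obtain y where y: "P i < y" "y < P (i + 1)" using dense[of "P i" "P (i + 1)"] by (auto simp: P_less)
  then show ?thesis using bump_onD(5)[OF bump_conj_a, of i y] by (force simp: id_on_def)
qed

lemma id_on_conj_a: "i \<noteq> j \<Longrightarrow> id_on (conj_a i) j"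
  unfolding id_on_def
proof (intro allI impI)
  fix y assume "i \<noteq> j" and y: "P j < y \<and> y < P (j + 1)"
  then have "P (j + 1) \<le> P i \<or> P (i + 1) \<le> P j"
    using strict_mono_less_eq[OF strict_mono_P] by auto
  then show "conj_a i y = y" using y by (intro bump_onD(6)[OF bump_conj_a]) auto
qed

lemma id_on_conj_zpow: "id_on (zpow t m \<circ> b \<circ> zpow t (- m)) i \<longleftrightarrow> id_on b (i - m)"
proof -
  have less: "zpow t m y < zpow t m z \<longleftrightarrow> y < z" for y z
    by (rule strict_mono_less[OF strict_mono_zpow[OF t_in bump_t]])
  have P: "P i = zpow t m (P (i - m))" for i by (simp add: P_def zpow_cancel')
  have c: "zpow t m (zpow t (- m) y) = y" "zpow t (- m) (zpow t m y) = y" for y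
    by (simp_all add: zpow_cancel')
  have eq: "zpow t m y = z \<longleftrightarrow> y = zpow t (- m) z" for y z using c by metis
  have "id_on (zpow t m \<circ> b \<circ> zpow t (- m)) i \<longleftrightarrow>
      (\<forall>y. P i < zpow t m y \<and> zpow t m y < P (i + 1) \<longrightarrow> zpow t m (b y) = zpow t m y)"
    unfolding id_on_def comp_apply using c by metis
  also have "\<dots> \<longleftrightarrow> id_on b (i - m)"
    unfolding id_on_def P[of i] P[of "i + 1"] less eq c by (simp add: algebra_simps)
  finally show ?thesis .
qed

text \<open>Write a_i for \<open>conj_a i\<close> and n = m q. The solution is b = a_0 a_m ...
  a_{(q-1)m}. Conjugation by \<open>t ^^ m\<close> turns it into a_m a_{2m} ... a_{qm}, and
  multiplying this by a = a_0 gives a_n b, as all factors commute.\<close>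

lemma divides_if_dvd:
  assumes "m dvd n"
  shows "divides G mul t a (t ^^ m) (t ^^ n)"
proof -
  define Z where "Z q = conj_a (int m * int q)" for q :: nat
  define B where "B = rec_nat id (\<lambda>q b. b \<circ> Z q)"
  have B: "B 0 = id" "B (Suc q) = B q \<circ> Z q" for q by (simp_all add: B_def)
  define Y where "Y q = zpow t (int m) \<circ> B q \<circ> zpow t (- int m)" for q
  have B_in: "B q \<in> G" for q
  proof (induction q)
    case 0
    show ?case unfolding B by (rule id_in)
  next
    case (Suc q)
    show ?case unfolding B Z_def by (rule comp_in[OF Suc conj_a_in])
  qed
  have B_comm: "conj_a i \<circ> B q = B q \<circ> conj_a i" for i q
  proof (induction q)
    case (Suc q)
    then show ?case unfolding B Z_def using conj_a_commute[of i "int m * int q"] by (metis comp_assoc)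
  qed (simp add: B)
  have Y_Suc: "Y (Suc q) = Y q \<circ> Z (Suc q)" for q
  proof -
    have "Z (Suc q) = zpow t (int m) \<circ> Z q \<circ> zpow t (- int m)"
      unfolding Z_def conj_conj_a by (simp add: algebra_simps)
    then have "Y q \<circ> Z (Suc q) = zpow t (int m) \<circ> B q \<circ> (zpow t (- int m) \<circ> zpow t (int m)) \<circ> Z q \<circ>
        zpow t (- int m)"
      unfolding Y_def by (simp only: comp_assoc)
    also have "\<dots> = Y (Suc q)" by (simp only: zpow_comp Y_def B comp_assoc) simp
    finally show ?thesis by simp
  qed
  have Y: "Y q \<circ> a = Z q \<circ> B q" for q
  proof (induction q)
    case 0
    then show ?case unfolding Y_def B Z_def comp_id zpow_comp by (simp add: conj_a_0)
  next
    case (Suc q)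
    have "Y (Suc q) \<circ> a = Y q \<circ> a \<circ> Z (Suc q)"
      unfolding Y_Suc Z_def using conj_a_commute[of "int m * int (Suc q)" 0] unfolding conj_a_0 by (metis comp_assoc)
    also have "\<dots> = Z q \<circ> B q \<circ> Z (Suc q)" by (simp only: Suc)
    also have "\<dots> = Z (Suc q) \<circ> B (Suc q)"
      unfolding B Z_def
      using B_comm[of "int m * int q" q] B_comm[of "int m * int (Suc q)" q]
        conj_a_commute[of "int m * int q" "int m * int (Suc q)"] by (metis comp_assoc)
    finally show ?case .
  qed
  obtain q where q: "n = m * q" using assms by blast
  have "in_base G mul t a (B q)" using B_comm by (simp add: in_base_iff)
  moreover have "Y q \<circ> t ^^ m = t ^^ m \<circ> B q"
    using zpow_comp[of "- int m" "int m"] unfolding Y_def comp_assoc by simp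
  moreover have "Z q \<circ> t ^^ n = t ^^ n \<circ> a"
    using conj_a_zpow[of "int n"] unfolding zpow_of_nat by (simp add: Z_def q)
  moreover have "Y q \<in> G" "Z q \<in> G"
    unfolding Y_def Z_def by (intro comp_in zpow_in' B_in, intro conj_a_in)
  ultimately show ?thesis unfolding divides_def using B_in Y by metis
qed

text \<open>Off the domains 0 and n the equation makes y and b agree, and y is b shifted by m
  domains. If m does not divide n, triviality of b spreads along the multiples of m from both ends
  until y and b are trivial on domain 0, where the equation then makes \<open>a\<close> trivial
  too.\<close>

lemma dvd_if_divides:
  assumes "divides G mul t a (t ^^ m) (t ^^ n)"
  shows "m dvd n"
proof (rule ccontr)
  assume ndvd: "\<not> m dvd n"
  obtain b y z where b: "b \<in> G" "in_base G mul t a b"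
    and y: "y \<circ> t ^^ m = t ^^ m \<circ> b" and z: "z \<circ> t ^^ n = t ^^ n \<circ> a" and yz: "y \<circ> a = z \<circ> b"
    using assms unfolding divides_def by metis
  have comm: "conj_a i \<circ> b = b \<circ> conj_a i" for i using b by (simp add: in_base_iff)
  have z': "z = conj_a (int n)" using z conj_a_unique[of z "int n"] by simp
  have y': "y = zpow t (int m) \<circ> b \<circ> zpow t (- int m)"
  proof -
    have "y = y \<circ> (zpow t (int m) \<circ> zpow t (- int m))" by (simp only: zpow_comp) simp
    also have "\<dots> = (y \<circ> t ^^ m) \<circ> zpow t (- int m)" by (simp add: comp_assoc)
    finally show ?thesis unfolding y by simp
  qed
  have n: "n \<noteq> 0" using ndvd by (metis dvd_0_right)
  have range_b: "P i < b w \<and> b w < P (i + 1) \<longleftrightarrow> P i < w \<and> w < P (i + 1)" for i w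
    by (rule base_range[OF b(1) comm])
  have y_eq: "id_on y i \<longleftrightarrow> id_on b i" if "i \<noteq> 0" "i \<noteq> int n" for i
  proof -
    have "y w = b w" if w: "P i < w \<and> w < P (i + 1)" for w
    proof -
      have "y (a w) = z (b w)" using yz by (metis comp_apply)
      moreover have "a w = w" using id_on_conj_a[of 0 i] w \<open>i \<noteq> 0\<close> by (auto simp: conj_a_0 id_on_def)
      moreover have "z (b w) = b w"
        using id_on_conj_a[of "int n" i] range_b w \<open>i \<noteq> int n\<close> by (auto simp: z' id_on_def)
      ultimately show ?thesis by simp
    qed
    then show ?thesis by (auto simp: id_on_def)
  qed
  have y_id: "id_on y i \<longleftrightarrow> id_on b (i - int m)" for i unfolding y' by (rule id_on_conj_zpow)
  show False
  proof (cases "m = 0")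
    case True
    \<comment> \<open>Conjugation by \<open>t ^^ 0\<close> changes nothing; cancelling b leaves a =
      a_n with n > 0, which have different supports.\<close>
    then have "y = b" by (simp add: y')
    then have "conj_a (int n) \<circ> b = a \<circ> b" using yz comm[of 0] unfolding z' conj_a_0 by simp
    then have "conj_a (int n) = a" using bij_in[OF b(1)]
      by (metis bij_def comp_assoc comp_id surj_iff)
    then show False using not_id_on_conj_a[of 0] id_on_conj_a[of "int n" 0] n by (simp add: conj_a_0)
  next
    case False
    have nm: "int n \<noteq> int m * int j" "int n \<noteq> - int m * int j" if "0 < j" for j :: nat
    proof -
      show "int n \<noteq> int m * int j" using ndvd by (metis dvd_triv_left of_nat_eq_iff of_nat_mult)
      have "- int m * int j \<le> 0" by simp
      then show "int n \<noteq> - int m * int j" using n by linarith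
    qed
    obtain k where k: "\<And>i. i \<le> - int k \<Longrightarrow> id_on b i" using base_id_near_0[OF b(1) comm] by blast
    obtain k' where k': "\<And>i. int k' \<le> i \<Longrightarrow> id_on b i" using base_id_near_r[OF b(1) comm] by blast
    \<comment> \<open>Downward induction on j, starting so far to the left that b is trivial:
      triviality of b on one domain gives that of y on the domain m further right, and y agrees with
      b there. The case j = 0 stops at domain -m, which is domain 0 for y.\<close>
    have left: "id_on b (- (int m * int (Suc j)))" if "j \<le> k" for j
      using that
    proof (induction rule: inc_induct)
      case base
      have "int k \<le> int m * int (Suc k)"
        using False mult_mono[of 1 "int m" "int k" "int (Suc k)"] by simp
      then show ?case using k by simp
    next
      case (step j)
      let ?i = "- (int m * int (Suc j))"
      have "id_on y ?i" unfolding y_id using step by (simp add: algebra_simps)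
      then show ?case using y_eq[of ?i] False nm(2)[of "Suc j"] by simp
    qed
    \<comment> \<open>The same from the right end, this time passing from b to y on one domain and
      then to b on the domain m further left, down to domain 0.\<close>
    have right: "id_on b (int m * int j)" if "j \<le> k'" for j
      using that
    proof (induction rule: inc_induct)
      case base
      have "int k' \<le> int m * int k'"
        using False mult_right_mono[of 1 "int m" "int k'"] by simp
      then show ?case using k' by simp
    next
      case (step j)
      let ?i = "int m * int (Suc j)"
      have "id_on y ?i" using step y_eq[of ?i] False nm(1)[of "Suc j"] by simp
      then show ?case by (simp add: y_id algebra_simps)
    qed
    have y0: "id_on y 0" using left[of 0] by (simp add: y_id)
    have b0: "id_on b 0" using right[of 0] by simp
    have "conj_a 0 w = w" if w: "P 0 < w \<and> w < P (0 + 1)" for w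
    proof -
      have "P 0 < a w \<and> a w < P (0 + 1)" using bump_on_range[OF bump_conj_a, of 0 w] w by (simp add: conj_a_0)
      then have "y (a w) = a w" using y0 by (simp add: id_on_def)
      moreover have "b w = w" using b0 w by (simp add: id_on_def)
      moreover have "z w = w" using id_on_conj_a[of "int n" 0] n w by (simp add: z' id_on_def)
      ultimately show ?thesis using yz unfolding conj_a_0 by (metis comp_apply)
    qed
    then show False using not_id_on_conj_a[of 0] by (simp add: id_on_def)
  qed
qed

theorem interprets_arith: "interprets_arith_params G mul id"
proof -
  interpret divisibility_model G mul id t a u "\<lambda>n. t ^^ n"
  proof
    show "t ^^ n \<in> G" for n using zpow_in'[of "int n"] by simp
    show "inj (\<lambda>n. t ^^ n)"
    proof (rule injI)
      fix m n assume "t ^^ m = t ^^ n"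
      then have "P (int m) = P (int n)" by (simp add: P_def)
      then show "m = n" using strict_mono_eq[OF strict_mono_P] by simp
    qed
    show "t ^^ (i + j) = t ^^ j \<circ> t ^^ i" for i j by (metis add.commute funpow_add)
    show "h \<in> G \<Longrightarrow> is_nat G mul t a u h \<longleftrightarrow> h \<in> range (\<lambda>n. t ^^ n)" for h
      by (rule is_nat_iff)
    show "divides G mul t a (t ^^ i) (t ^^ j) \<longleftrightarrow> i dvd j" for i j
      using divides_if_dvd dvd_if_divides by blast
  qed (use t_in a_in u_in in simp_all)
  show ?thesis by (rule interprets_arith)
qed

end

section \<open>Membership in the groups V and F\<close>

text \<open>Sorting the finite set \<open>P\<close> yields the required subdivision. A set is used
  instead of a sequence because the breakpoints in question may coincide, for instance when a bump
  starts at 0 or ends at r.\<close>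

lemma PL_V_if_finite_breakpoints:
  assumes "r > 0" "\<And>y. y \<notin> {0..<r} \<Longrightarrow> f y = y" "bij_betw f {0..<r} {0..<r}"
    and P: "finite P" "P \<subseteq> {0..r}" "P \<subseteq> A" "0 \<in> P" "r \<in> P" "f ` P \<subseteq> A"
    and aff: "\<And>x y. x \<in> P \<Longrightarrow> y \<in> P \<Longrightarrow> x < y \<Longrightarrow> (\<And>z. z \<in> P \<Longrightarrow> z \<le> x \<or> y \<le> z) \<Longrightarrow>
      \<exists>s\<in>\<Lambda>. \<exists>c. \<forall>z\<in>{x..<y}. f z = s * z + c"
  shows "f \<in> PL_V r \<Lambda> A"
proof -
  define xs where "xs = sorted_list_of_set P"
  define n where "n = length xs - 1"
  have set: "set xs = P" using P(1) by (simp add: xs_def)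
  have sorted: "sorted_wrt (<) xs" unfolding xs_def by (rule strict_sorted_list_of_set)
  have len: "length xs = Suc n" using set P(4) by (cases xs) (auto simp: n_def)
  have less: "xs ! i < xs ! j" if "i < j" "j \<le> n" for i j
    using sorted_wrt_nth_less[OF sorted] that len by simp
  then have le: "xs ! i \<le> xs ! j" if "i \<le> j" "j \<le> n" for i j
    using that by (metis le_neq_implies_less less_imp_le order_refl)
  have mem: "xs ! i \<in> P" if "i \<le> n" for i using that len set by (metis le_imp_less_Suc nth_mem)
  have ex: "\<exists>i\<le>n. z = xs ! i" if "z \<in> P" for z
    using that len set by (metis in_set_conv_nth less_Suc_eq_le)
  have "xs ! 0 = 0"
  proof -
    obtain i where "i \<le> n" "0 = xs ! i" using ex[OF P(4)] by blast
    then show ?thesis using le[of 0 i] subsetD[OF P(2) mem[of 0]] by simp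
  qed
  moreover have "xs ! n = r"
  proof -
    obtain i where "i \<le> n" "r = xs ! i" using ex[OF P(5)] by blast
    then show ?thesis using le[of i n] subsetD[OF P(2) mem[of n]] by simp
  qed
  moreover have "\<exists>s\<in>\<Lambda>. \<exists>c. \<forall>z\<in>{xs ! i..<xs ! Suc i}. f z = s * z + c" if i: "i < n" for i
  proof (rule aff)
    fix z assume "z \<in> P"
    then obtain j where "j \<le> n" "z = xs ! j" using ex by blast
    then show "z \<le> xs ! i \<or> xs ! Suc i \<le> z"
      using le[of j i] le[of "Suc i" j] i by (cases "j \<le> i") auto
  qed (use i mem[of i] mem[of "Suc i"] less[of i "Suc i"] in auto)
  moreover have "xs ! i \<in> A" "f (xs ! i) \<in> A" if "i \<le> n" for i
    using mem[OF that] P(3,6) by auto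
  moreover have "xs ! i < xs ! Suc i" if "i < n" for i using less[of i "Suc i"] that by simp
  ultimately have "\<exists>n a. a 0 = 0 \<and> a n = r \<and> (\<forall>i<n. a i < a (Suc i)) \<and> (\<forall>i\<le>n. a i \<in> A) \<and>
      (\<forall>i<n. f (a i) \<in> A \<and> (\<exists>s\<in>\<Lambda>. \<exists>c. \<forall>t\<in>{a i..<a (Suc i)}. f t = s * t + c))"
    by (intro exI[of _ n] exI[of _ "(!) xs"] conjI allI impI) simp_all
  then show ?thesis unfolding PL_V_def using assms(2,3) by blast
qed

lemma (in three_pieces) pl3_in_PL_F:
  assumes r: "0 \<le> p" "q \<le> r" and A: "p \<in> A" "q \<in> A" "d1 \<in> A" "d2 \<in> A" "0 \<in> A" "r \<in> A"
    and add: "\<forall>x\<in>A. \<forall>y\<in>A. x + y \<in> A" and uminus: "\<forall>x\<in>A. - x \<in> A"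
    and \<Lambda>: "1 \<in> \<Lambda>" "\<alpha> \<in> \<Lambda>" "\<beta> \<in> \<Lambda>" and scale: "\<forall>s\<in>\<Lambda>. \<forall>x\<in>A. s * x \<in> A"
  shows "pl3 p q d1 d2 \<alpha> \<beta> \<in> PL_F r \<Lambda> A"
proof -
  let ?f = "pl3 p q d1 d2 \<alpha> \<beta>"
  have pq: "p < q" using d fit by simp
  have minus: "x - y \<in> A" if "x \<in> A" "y \<in> A" for x y
    using that add uminus by (metis diff_conv_add_uminus)
  have less: "?f x < ?f y \<longleftrightarrow> x < y" for x y by (rule strict_mono_less[OF strict_mono_pl3])
  have f0: "?f 0 = 0" and fr: "?f r = r" using pl3_out r by auto
  have out: "?f y = y" if "y \<notin> {0..<r}" for y using that r by (intro pl3_out) auto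
  have range: "?f y \<in> {0..<r} \<longleftrightarrow> y \<in> {0..<r}" for y
    using less[of y 0] less[of y r] f0 fr by auto
  have "bij_betw ?f {0..<r} {0..<r}"
    unfolding bij_betw_def
  proof
    show "inj_on ?f {0..<r}" using strict_mono_imp_inj_on[OF strict_mono_pl3, of UNIV] by (rule inj_on_subset) simp
    show "?f ` {0..<r} = {0..<r}" using range surj_pl3 by (force simp: surj_def image_iff)
  qed
  \<comment> \<open>No listed point lies strictly between x and y, so the gap stays in the piece
    that contains its left end x.\<close>
  moreover have "\<exists>s\<in>\<Lambda>. \<exists>c. \<forall>z\<in>{x..<y}. ?f z = s * z + c"
    if "\<And>z. z \<in> {0, p, p + d1, q - d2, q, r} \<Longrightarrow> z \<le> x \<or> y \<le> z" for x y
  proof (cases x rule: pl3_cases)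
    case 1
    then have "\<forall>z\<in>{x..<y}. ?f z = 1 * z + 0" using that[of p] by (auto intro!: pl3_out)
    then show ?thesis using \<Lambda> by blast
  next
    case 2
    then have "\<forall>z\<in>{x..<y}. ?f z = \<alpha> * z + (p - \<alpha> * p)"
      using that[of "p + d1"] by (auto simp: pl3_left algebra_simps)
    then show ?thesis using \<Lambda> by blast
  next
    case 3
    then have "\<forall>z\<in>{x..<y}. ?f z = 1 * z + (\<alpha> - 1) * d1"
      using that[of "q - d2"] by (auto simp: pl3_mid)
    then show ?thesis using \<Lambda> by blast
  next
    case 4
    then have "\<forall>z\<in>{x..<y}. ?f z = \<beta> * z + (q - \<beta> * q)"
      using that[of q] by (auto simp: pl3_right algebra_simps)
    then show ?thesis using \<Lambda> by blast
  qed
  moreover have "?f ` {0, p, p + d1, q - d2, q, r} \<subseteq> A"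
  proof -
    have "?f p = p" "?f q = q" "?f (p + d1) = p + \<alpha> * d1" "?f (q - d2) = q - \<beta> * d2"
      using d fit by (auto simp: pl3_out pl3_left pl3_right)
    moreover have "p + \<alpha> * d1 \<in> A" "q - \<beta> * d2 \<in> A"
      using A \<Lambda> scale add minus[of q "\<beta> * d2"] by blast+
    ultimately show ?thesis using f0 fr A by simp
  qed
  moreover have "{0, p, p + d1, q - d2, q, r} \<subseteq> {0..r}" using r d fit by auto
  moreover have "{0, p, p + d1, q - d2, q, r} \<subseteq> A" using A add minus by auto
  ultimately have "?f \<in> PL_V r \<Lambda> A"
    using out r pq by (intro PL_V_if_finite_breakpoints[where P = "{0, p, p + d1, q - d2, q, r}"]) auto
  moreover have "continuous_on UNIV ?f"
    by (rule continuous_onI_mono) (use surj_pl3 strict_mono_pl3 in \<open>auto simp: strict_mono_less_eq\<close>)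
  ultimately show ?thesis unfolding PL_F_def using continuous_on_subset by auto
qed

section \<open>Elements of V as bijections that are affine near both ends\<close>

lemma PL_V_bij:
  assumes "f \<in> PL_V r \<Lambda> A"
  shows "bij f"
proof -
  have "bij_betw f {0..<r} {0..<r}" using assms by (simp add: PL_V_def)
  moreover have "bij_betw f (- {0..<r}) (- {0..<r})"
    using assms bij_betw_cong[of "- {0..<r}" f id] by (auto simp: PL_V_def)
  ultimately show ?thesis using bij_betw_combine[of f "{0..<r}" "{0..<r}" "- {0..<r}" "- {0..<r}"] by simp
qed

lemma PL_V_affine_ends:
  assumes f: "f \<in> PL_V r \<Lambda> A" and "0 < r"
  shows "\<exists>\<epsilon>>0. \<exists>s\<in>\<Lambda>. \<exists>c. \<forall>v. 0 \<le> v \<and> v < \<epsilon> \<longrightarrow> f v = s * v + c"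
    and "\<exists>\<epsilon><r. \<exists>s\<in>\<Lambda>. \<exists>c. \<forall>v. \<epsilon> < v \<and> v < r \<longrightarrow> f v = s * v + c"
proof -
  obtain n :: nat and a :: "nat \<Rightarrow> real" where "a 0 = 0 \<and> a n = r \<and> (\<forall>i<n. a i < a (Suc i)) \<and>
      (\<forall>i\<le>n. a i \<in> A) \<and>
      (\<forall>i<n. f (a i) \<in> A \<and> (\<exists>s\<in>\<Lambda>. \<exists>c. \<forall>t\<in>{a i..<a (Suc i)}. f t = s * t + c))"
    using f unfolding PL_V_def mem_Collect_eq by (elim conjE exE) simp
  then have a: "a 0 = 0" "a n = r" "\<And>i. i < n \<Longrightarrow> a i < a (Suc i)"
    "\<And>i. i < n \<Longrightarrow> \<exists>s\<in>\<Lambda>. \<exists>c. \<forall>t\<in>{a i..<a (Suc i)}. f t = s * t + c"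
    by simp_all
  obtain m where m: "n = Suc m" using a(1,2) assms(2) by (cases n) auto
  show "\<exists>\<epsilon>>0. \<exists>s\<in>\<Lambda>. \<exists>c. \<forall>v. 0 \<le> v \<and> v < \<epsilon> \<longrightarrow> f v = s * v + c"
  proof -
    obtain s c where "s \<in> \<Lambda>" "\<forall>t\<in>{a 0..<a (Suc 0)}. f t = s * t + c" using a(4)[of 0] m by blast
    then show ?thesis using a(3)[of 0] a(1) m by (intro exI[of _ "a (Suc 0)"]) auto
  qed
  show "\<exists>\<epsilon><r. \<exists>s\<in>\<Lambda>. \<exists>c. \<forall>v. \<epsilon> < v \<and> v < r \<longrightarrow> f v = s * v + c"
  proof -
    obtain s c where "s \<in> \<Lambda>" "\<forall>t\<in>{a m..<a (Suc m)}. f t = s * t + c" using a(4)[of m] m by blast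
    then show ?thesis using a(3)[of m] a(2) m by (intro exI[of _ "a m"]) auto
  qed
qed

lemma end_affine_group_subgroup:
  assumes "0 < r" and G: "subgroup G (Vgrp r {0<..} UNIV)"
  shows "end_affine_group G r"
proof
  have sub: "G \<subseteq> PL_V r {0<..} UNIV"
    using subgroup.subset[OF G] by (simp add: Vgrp_def)
  show "id \<in> G" using subgroup.one_closed[OF G] by (simp add: Vgrp_def)
  show "x \<circ> y \<in> G" if "x \<in> G" "y \<in> G" for x y
    using subgroup.m_closed[OF G that(2,1)] by (simp add: Vgrp_def)
  fix x assume "x \<in> G"
  then have x: "x \<in> PL_V r {0<..} UNIV" using sub by blast
  show "bij x" using x by (rule PL_V_bij)
  show "v \<notin> {0..<r} \<Longrightarrow> x v = v" for v using x by (simp add: PL_V_def)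
  show "\<exists>\<epsilon>>0. \<exists>s>0. \<exists>c. \<forall>v. 0 \<le> v \<and> v < \<epsilon> \<longrightarrow> x v = s * v + c"
    using PL_V_affine_ends(1)[OF x assms(1)] unfolding Bex_def greaterThan_iff .
  show "\<exists>\<epsilon><r. \<exists>s>0. \<exists>c. \<forall>v. \<epsilon> < v \<and> v < r \<longrightarrow> x v = s * v + c"
    using PL_V_affine_ends(2)[OF x assms(1)] unfolding Bex_def greaterThan_iff .
qed (rule assms(1))

section \<open>Choice of the three parameters\<close>

theorem theoremA:
  fixes r :: real and \<Lambda> A :: "real set" and G :: "(real \<Rightarrow> real) set"
  assumes r_pos: "r > 0"
    and Lambda_pos: "\<Lambda> \<subseteq> {0<..}"
    and Lambda_one: "1 \<in> \<Lambda>"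
    and Lambda_mult: "\<forall>x\<in>\<Lambda>. \<forall>y\<in>\<Lambda>. x * y \<in> \<Lambda>"
    and Lambda_inv: "\<forall>x\<in>\<Lambda>. inverse x \<in> \<Lambda>"
    and Lambda_nontriv: "\<Lambda> \<noteq> {1}"
    and A_zero: "0 \<in> A"
    and A_add: "\<forall>x\<in>A. \<forall>y\<in>A. x + y \<in> A"
    and A_uminus: "\<forall>x\<in>A. - x \<in> A"
    and r_in_A: "r \<in> A"
    and A_Lambda: "\<forall>s\<in>\<Lambda>. \<forall>a\<in>A. s * a \<in> A"
    and G_sub: "subgroup G (Vgrp r {0<..} UNIV)"
    and G_F: "G \<inter> PL_F r {0<..} UNIV = PL_F r \<Lambda> A"
  shows "interprets_arith_params G (\<lambda>x y. y \<circ> x) id"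
proof -
  interpret end_affine_group G r by (rule end_affine_group_subgroup[OF r_pos G_sub])
  obtain l where l: "l \<in> \<Lambda>" "1 < l"
  proof -
    have "\<not> \<Lambda> \<subseteq> {1}" using Lambda_one Lambda_nontriv by (metis empty_iff subset_singletonD)
    then obtain x where x: "x \<in> \<Lambda>" "x \<noteq> 1" by auto
    have "x > 0" using subsetD[OF Lambda_pos x(1)] by simp
    then have "1 < x \<or> 1 < inverse x" using x(2) by (simp add: one_less_inverse_iff) linarith
    then show ?thesis using that x(1) Lambda_inv by blast
  qed
  have l2: "l\<^sup>2 \<in> \<Lambda>" "1 / l \<in> \<Lambda>" "1 < l\<^sup>2" "1 / l\<^sup>2 \<in> \<Lambda>"
    using l Lambda_mult Lambda_inv by (auto simp: power2_eq_square inverse_eq_divide[symmetric] intro: less_1_mult)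
  \<comment> \<open>Multiplying by powers of 1/l makes elements of \<open>A\<close> arbitrarily
    small without leaving \<open>A\<close>.\<close>
  have small: "\<exists>x\<in>A. 0 < x \<and> x * (1 + l + l\<^sup>2) < y" if y: "y \<in> A" "0 < y" for y
  proof -
    obtain k where k: "1 + l + l\<^sup>2 < l ^ k" using real_arch_pow[OF l(2)] by blast
    have "y * (1 / l) ^ k \<in> A"
      by (induction k) (use y A_Lambda l2(2) in \<open>auto simp: ac_simps\<close>)
    moreover have "0 < y * (1 / l) ^ k" using y l by simp
    moreover have "y * (1 / l) ^ k * (1 + l + l\<^sup>2) < y"
      using mult_strict_left_mono[OF k, of y] y l by (simp add: power_divide field_simps)
    ultimately show ?thesis by blast
  qed
  \<comment> \<open>With slopes \<open>l\<^sup>2\<close> and \<open>1 / l\<close>, the outer lengths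
    must satisfy \<open>(l\<^sup>2 - 1) * d1 = (1 - 1 / l) * d2\<close>, that is,
    \<open>d2 = (l + l\<^sup>2) * d1\<close>. Their sum is \<open>x * (1 + l + l\<^sup>2)\<close>,
    which leaves room for a middle piece.\<close>
  have pieces: "three_pieces p q x ((l + l\<^sup>2) * x) (l\<^sup>2) (1 / l)"
    if "0 < x" "x * (1 + l + l\<^sup>2) < q - p" for p q x
    using that l by unfold_locales (auto simp: field_simps power2_eq_square intro: add_pos_pos)
  have in_F: "pl3 p q d1 d2 \<alpha> \<beta> \<in> G"
    if "three_pieces p q d1 d2 \<alpha> \<beta>" "\<alpha> \<in> \<Lambda>" "\<beta> \<in> \<Lambda>" "0 \<le> p" "q \<le> r" "p \<in> A" "q \<in> A" "d1 \<in> A" "d2 \<in> A"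
    for p q d1 d2 \<alpha> \<beta>
    using three_pieces.pl3_in_PL_F[OF that(1,4-9) A_zero r_in_A A_add A_uminus Lambda_one that(2,3) A_Lambda]
      G_F by blast
  have scaled: "(l + l\<^sup>2) * x \<in> A" if "x \<in> A" for x
    using that l l2 A_Lambda A_add by (simp add: distrib_right)
  have bump: "\<exists>x\<in>G. bump_on x p q" if pq: "p < q" "p \<in> A" "q \<in> A" "0 \<le> p" "q \<le> r" for p q
  proof -
    have "q - p \<in> A" using pq A_add A_uminus by (metis diff_conv_add_uminus)
    then obtain d where d: "d \<in> A" "0 < d" "d * (1 + l + l\<^sup>2) < q - p"
      using small[of "q - p"] pq(1) by fastforce
    note pc = pieces[OF d(2,3)]
    show ?thesis
      using in_F[OF pc l2(1,2) pq(4,5,2,3) d(1) scaled[OF d(1)]] three_pieces.bump_on_pl3[OF pc l2(3)] by blast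
  qed
  obtain e where e: "e \<in> A" "0 < e" "e * (1 + l + l\<^sup>2) < r" using small[OF r_in_A r_pos] by blast
  define t where "t = pl3 0 r e ((l + l\<^sup>2) * e) (l\<^sup>2) (1 / l)"
  have tp: "three_pieces 0 r e ((l + l\<^sup>2) * e) (l\<^sup>2) (1 / l)" using pieces[of e r 0] e by simp
  have t_in: "t \<in> G"
    unfolding t_def using in_F[OF tp l2(1,2)] A_zero r_in_A e scaled by simp
  have bump_t: "bump_on t 0 r" unfolding t_def by (rule three_pieces.bump_on_pl3[OF tp l2(3)])
  have inv_t: "inv_into UNIV t \<in> G"
    unfolding t_def three_pieces.inv_pl3[OF tp]
  proof (rule in_F[OF three_pieces.three_pieces_inverse[OF tp]])
    show "l\<^sup>2 * e \<in> A" "1 / l * ((l + l\<^sup>2) * e) \<in> A" using bspec[OF bspec[OF A_Lambda l2(1)] e(1)] bspec[OF bspec[OF A_Lambda l2(2)] scaled[OF e(1)]] by simp_all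
  qed (use l l2 A_zero r_in_A in auto)
  have "e < r"
  proof -
    have "e * 1 < e * (1 + l + l\<^sup>2)" using l e(2) by (intro mult_strict_left_mono) (auto intro: add_pos_pos)
    then show ?thesis using e(3) by simp
  qed
  \<comment> \<open>The two breakpoints of \<open>t\<close> are distinct, so their jumps stay
    separate.\<close>
  have gap: "e < r - (l + l\<^sup>2) * e" using e(3) by (simp add: algebra_simps)
  have te: "t e = l\<^sup>2 * e" unfolding t_def using three_pieces.pl3_left[OF tp, of e] e by simp
  have "e < t e" "t e < r" using bump_onD(5)[OF bump_t, of e] bump_on_range[OF bump_t, of e] e \<open>e < r\<close> by auto
  then obtain a where a: "a \<in> G" "bump_on a e (t e)"
    using bump[of e "t e"] e te l2 A_Lambda by auto
  obtain u where u: "u \<in> G" "bump_on u 0 e" using bump[of 0 e] e A_zero \<open>e < r\<close> by auto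
  \<comment> \<open>The slopes \<open>l\<^sup>2\<close> and \<open>1 / l\<close> were taken so that
    1/\<alpha> < \<beta> < 1; this tells the two breakpoints of \<open>t\<close> apart in the
    computation of its centralizer.\<close>
  have "l < l\<^sup>2" using l power_strict_increasing[of 1 2 l] by simp
  then have "1 / l\<^sup>2 < 1 / l" "1 / l < 1" using l by (simp_all add: frac_less2)
  then have "\<exists>i. h = zpow t i" if "h \<in> G" "h \<circ> t = t \<circ> h" for h
    using centralizer_pl3_subset_powers[OF tp l2(3) _ _ gap] t_in inv_t that unfolding t_def by blast
  then interpret wreath_setup G r t a u e
    using t_in inv_t a u e \<open>e < r\<close> bump_t by unfold_locales auto
  show ?thesis by (rule interprets_arith)
qed

end
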